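(* Let $F:\mathbb{R}^n\times\mathbb{R}^m\to\mathbb{R}$, $\phi:\mathbb{R}^n\times\mathbb{R}^m\to\mathbb{R}^m$, $G:\mathbb{R}^n\times\mathbb{R}^m\to\mathbb{R}^p$ be continuously differentiable, $g:\mathbb{R}^m\to\mathbb{R}^q$ twice continuously differentiable, $\Gamma=\{y\mid g(y)\le0\}$, and consider the problem (MPEC'): $\min_{x,y}F(x,y)$ s.t. $\hat P(x,y):=((y,-\phi(x,y)),G(x,y))\in\hat D:=\operatorname{gph}\widehat N_\Gamma\times\mathbb{R}^p_-$. Assume that $(\bar x,\bar y)$ is B-stationary for (MPEC'), that (i) the mapping $y\rightrightarrows g(y)-\mathbb{R}^q_-$ is metrically subregular at $(\bar y,0)$, and (ii) GGCQ holds at $(\bar x,\bar y)$ for the system $\hat P(x,y)\in\hat D$ and the mapping $(u,v)\rightrightarrows\nabla\hat P(\bar x,\bar y)(u,v)-T_{\hat D}(\hat P(\bar x,\bar y))$ is metrically subregular at $((0,0),0)$. Set $\bar y^\ast:=-\phi(\bar x,\bar y)$ and assume there is a set $\tilde\Lambda\subseteq\bar\Lambda$ such that $\bar\Lambda(v)=\tilde\Lambda$ for all $v\in\bar K_\Gamma\setminus\{0\}$. Then for every $\tilde\lambda\in\tilde\Lambda$ there exist $v\in\bar K_\Gamma$, $z^\ast\in N_{\bar K_\Gamma}(v)$ and multipliers $w\in\mathcal{K}_{\bar K_\Gamma}(v,z^\ast)$, $\mu\in N_{\mathbb{R}^p_-}(G(\bar x,\bar y))$ such that \[0=\nabla_xF(\bar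 x,\bar y)-\nabla_x\phi(\bar x,\bar y)^Tw+\nabla_xG(\bar x,\bar y)^T\mu,\] \[0\in\nabla_yF(\bar x,\bar y)-\nabla^2(\tilde\lambda^Tg)(\bar y)w-\nabla_y\phi(\bar x,\bar y)^Tw+\nabla_yG(\bar x,\bar y)^T\mu+(\mathcal{K}_{\bar K_\Gamma}(v,z^\ast))^\ast.\]
   Context: Tangent cone $T_\Omega(\bar z)=\{w\mid \exists t_k\downarrow0,\ w_k\to w,\ \bar z+t_kw_k\in\Omega\}$; polar cone $K^\ast=\{z^\ast\mid\langle z^\ast,w\rangle\le0\ \forall w\in K\}$; regular normal cone $\widehat N_\Omega(\bar z)=(T_\Omega(\bar z))^\ast$ (for convex $\Omega$ the usual normal cone, denoted $N_\Omega$); $\operatorname{gph}$ denotes graph. For a set $\Omega$, $\bar z\in\Omega$ and $\bar z^\ast\in\widehat N_\Omega(\bar z)$, the critical cone is $\mathcal{K}_\Omega(\bar z,\bar z^\ast)=T_\Omega(\bar z)\cap\{\bar z^\ast\}^\perp$. Here $\bar K_\Gamma:=\mathcal{K}_\Gamma(\bar y,\bar y^\ast)$, $\bar\Lambda=\{\lambda\in N_{\mathbb{R}^q_-}(g(\bar y))\mid\nabla g(\bar y)^T\lambda=\bar y^\ast\}$, and for $v\in\bar K_\Gamma$, $\bar\Lambda(v)=\operatorname{argmax}\{v^T\nabla^2(\lambda^Tg)(\bar y)v\mid\lambda\in\bar\Lambda\}$. Let $\Omega_M$ be the feasible set of (MPEC'); $(\bar x,\bar y)$ is B-stationary if $0\in\nabla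 F(\bar x,\bar y)+\widehat N_{\Omega_M}(\bar x,\bar y)$. GGCQ at $(\bar x,\bar y)$ means $\widehat N_{\Omega_M}(\bar x,\bar y)=(\{(u,v)\mid\nabla\hat P(\bar x,\bar y)(u,v)\in T_{\hat D}(\hat P(\bar x,\bar y))\})^\ast$. A mapping $M$ is metrically subregular at $(\bar z,\bar w)\in\operatorname{gph}M$ if there are a neighborhood $W$ of $\bar z$ and $\kappa>0$ with $\operatorname{dist}(z,M^{-1}(\bar w))\le\kappa\operatorname{dist}(\bar w,M(z))$ for $z\in W$. *)

theory Defs
  imports "HOL-Analysis.Analysis"
begin

definition tangent_cone :: "'a::real_normed_vector set \<Rightarrow> 'a \<Rightarrow> 'a set" where
  "tangent_cone \<Omega> z = {w. \<exists>t wk. (\<forall>k. t k > (0::real)) \<and> t \<longlonglongrightarrow> 0 \<and> wk \<longlonglongrightarrow> w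
       \<and> (\<forall>k. z + t k *\<^sub>R wk k \<in> \<Omega>)}"

definition polar_cone :: "'a::real_inner set \<Rightarrow> 'a set" where
  "polar_cone K = {zs. \<forall>w\<in>K. inner zs w \<le> 0}"

text \<open>Regular normal cone (empty outside the set, as usual; for convex sets this is
  the usual normal cone of convex analysis).\<close>
definition reg_normal :: "'a::real_inner set \<Rightarrow> 'a \<Rightarrow> 'a set" where
  "reg_normal \<Omega> z = (if z \<in> \<Omega> then polar_cone (tangent_cone \<Omega> z) else {})"

definition crit_cone :: "'a::real_inner set \<Rightarrow> 'a \<Rightarrow> 'a \<Rightarrow> 'a set" where
  "crit_cone \<Omega> z zs = tangent_cone \<Omega> z \<inter> {w. inner zs w = 0}"

definition gph :: "('a \<Rightarrow> 'b set) \<Rightarrow> ('a \<times> 'b) set" where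
  "gph M = {(z, w). w \<in> M z}"

definition nonpos_orthant :: "(real ^ 'k) set" where
  "nonpos_orthant = {z. \<forall>i. z $ i \<le> 0}"

definition grad :: "('a::euclidean_space \<Rightarrow> real) \<Rightarrow> 'a" where
  "grad L = (\<Sum>b\<in>Basis. L b *\<^sub>R b)"

text \<open>Metric subregularity of a set-valued map M at (zb, wb) in gph M.
  The distance to the empty set is +\<infinity>, so points z with M z = {} satisfy the
  inequality trivially (Isabelle's infdist of {} is 0, hence the guard).\<close>
definition metric_subregular :: "('a::metric_space \<Rightarrow> 'b::metric_space set) \<Rightarrow> 'a \<Rightarrow> 'b \<Rightarrow> bool" where
  "metric_subregular M zb wb \<longleftrightarrow> (zb, wb) \<in> gph M \<and>
     (\<exists>W \<kappa>. open W \<and> zb \<in> W \<and> \<kappa> > 0 \<and>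
        (\<forall>z\<in>W. M z \<noteq> {} \<longrightarrow> infdist z {z'. wb \<in> M z'} \<le> \<kappa> * infdist wb (M z)))"

end

theory Submission
  imports Defs
begin

text \<open>
  Fix \<open>lt\<close> and let \<open>H v\<close> be the derivative of \<open>y \<mapsto> \<nabla>g(y)\<^sup>T lt\<close> at \<open>yb\<close> in direction \<open>v\<close>. Only the inclusion
  \<open>T' \<subseteq> T\<close> of the tangent cone formula for \<open>D\<close> is needed, where \<open>T'\<close> consists of the
  \<open>((v, H v + z), s)\<close> with \<open>(v, z)\<close> in the graph of the normal cone of \<open>KG\<close> and \<open>s\<close> tangent to the
  orthant: B-stationarity and subregularity of the linearized system bound the objective below by
  \<open>- C * dist(DP z, T)\<close>, hence by \<open>- C * dist(DP z, T')\<close>.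

  For the inclusion, optimality of \<open>lt\<close> yields, by linear programming duality, a second-order
  correction \<open>w\<close> such that \<open>yb + t v + t\<^sup>2/2 w\<close> is feasible up to \<open>o(t\<^sup>2)\<close>; subregularity moves it to
  a point of \<open>\<Gamma>\<close> that maximizes \<open>(lt + t \<mu>)\<^sup>T g\<close> over \<open>\<Gamma>\<close> up to \<open>o(t\<^sup>2)\<close>. Penalizing by the squared
  distance to this point gives an exact minimizer at distance \<open>o(t)\<close>, and Fermat's rule there
  provides the required normal vector.

  Finally, a quadratic penalty gives multipliers that are normal to \<open>T'\<close> up to a vanishing error.
  They are bounded, and as \<open>T'\<close> is a finite union of polyhedral cones they lie in finitely many
  closed cones, so that an exact multiplier exists.
\<close>

section \<open>Polyhedral cones\<close>

text \<open>Indices of \<open>E\<close> outside \<open>I\<close> have no effect, so the index sets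
  of a critical cone arise from \<open>I\<close> by shrinking and from \<open>E\<close> by
  enlarging, independently of each other.\<close>

definition lin_cone :: "('q \<Rightarrow> 'a::real_inner) \<Rightarrow> 'q set \<Rightarrow> 'q set \<Rightarrow> 'a set" where
  "lin_cone a I E = {v. \<forall>i\<in>I. a i \<bullet> v \<le> 0 \<and> (i \<in> E \<longrightarrow> a i \<bullet> v = 0)}"

definition lin_mults :: "'q set \<Rightarrow> 'q set \<Rightarrow> (real^'q) set" where
  "lin_mults I E = {\<mu>. \<forall>i. (i \<notin> I \<longrightarrow> \<mu> $ i = 0) \<and> (i \<notin> E \<longrightarrow> 0 \<le> \<mu> $ i)}"

lemma lin_mults_inner_nonpos:
  assumes "\<mu> \<in> lin_mults I E" "v \<in> lin_cone a I E"
  shows "\<mu> $ i * (a i \<bullet> v) \<le> 0"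
  using assms unfolding lin_mults_def lin_cone_def
  by (cases "i \<in> I"; cases "i \<in> E") (auto simp: mult_nonneg_nonpos)

text \<open>The admissible combinations form a convex cone that contains the conic hull of the
  \<open>a i\<close>, taken with both signs at equality indices. This hull is finitely generated,
  hence closed. A point outside it is strictly separated from it, and the negative of the separating
  vector lies in \<open>lin_cone a I E\<close>, which contradicts polarity.\<close>

lemma farkas:
  fixes a :: "'q::finite \<Rightarrow> 'a::euclidean_space"
  assumes z: "z \<in> polar_cone (lin_cone a I E)"
  shows "\<exists>\<mu>\<in>lin_mults I E. z = (\<Sum>i\<in>UNIV. \<mu> $ i *\<^sub>R a i)"
proof -
  define S where "S = a ` I \<union> (\<lambda>i. - a i) ` (I \<inter> E)"
  define C where "C = (\<lambda>\<mu>. \<Sum>i\<in>UNIV. \<mu> $ i *\<^sub>R a i) ` lin_mults I E"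
  have "convex_cone C"
    unfolding convex_cone_iff C_def
  proof (intro conjI ballI allI impI)
    show "0 \<in> (\<lambda>\<mu>. \<Sum>i\<in>UNIV. \<mu> $ i *\<^sub>R a i) ` lin_mults I E"
      by (rule image_eqI[of _ _ 0]) (auto simp: lin_mults_def)
  next
    fix x y assume "x \<in> (\<lambda>\<mu>. \<Sum>i\<in>UNIV. \<mu> $ i *\<^sub>R a i) ` lin_mults I E"
      and "y \<in> (\<lambda>\<mu>. \<Sum>i\<in>UNIV. \<mu> $ i *\<^sub>R a i) ` lin_mults I E"
    then obtain \<mu> \<nu> where "\<mu> \<in> lin_mults I E" "\<nu> \<in> lin_mults I E"
      "x = (\<Sum>i\<in>UNIV. \<mu> $ i *\<^sub>R a i)" "y = (\<Sum>i\<in>UNIV. \<nu> $ i *\<^sub>R a i)"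
      by auto
    then show "x + y \<in> (\<lambda>\<mu>. \<Sum>i\<in>UNIV. \<mu> $ i *\<^sub>R a i) ` lin_mults I E"
      by (intro image_eqI[of _ _ "\<mu> + \<nu>"])
         (auto simp: lin_mults_def scaleR_add_left sum.distrib)
  next
    fix x and c :: real assume "x \<in> (\<lambda>\<mu>. \<Sum>i\<in>UNIV. \<mu> $ i *\<^sub>R a i) ` lin_mults I E" "0 \<le> c"
    then obtain \<mu> where "\<mu> \<in> lin_mults I E" "x = (\<Sum>i\<in>UNIV. \<mu> $ i *\<^sub>R a i)"
      by auto
    then show "c *\<^sub>R x \<in> (\<lambda>\<mu>. \<Sum>i\<in>UNIV. \<mu> $ i *\<^sub>R a i) ` lin_mults I E"
      using \<open>0 \<le> c\<close> by (intro image_eqI[of _ _ "c *\<^sub>R \<mu>"])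
         (auto simp: lin_mults_def scaleR_sum_right)
  qed
  moreover have "S \<subseteq> C"
  proof -
    have "a i \<in> C" if "i \<in> I" for i
      unfolding C_def using that
      by (intro image_eqI[of _ _ "axis i 1"])
         (auto simp: lin_mults_def axis_def if_distrib[of "\<lambda>x. x *\<^sub>R _"] cong: if_cong)
    moreover have "- a i \<in> C" if "i \<in> I" "i \<in> E" for i
      unfolding C_def using that
      by (intro image_eqI[of _ _ "axis i (- 1)"])
         (auto simp: lin_mults_def axis_def if_distrib[of "\<lambda>x. x *\<^sub>R _"] cong: if_cong)
    ultimately show ?thesis unfolding S_def by auto
  qed
  ultimately have hull: "convex_cone hull S \<subseteq> C"
    by (simp add: hull_minimal)
  have "z \<in> convex_cone hull S"
  proof (rule ccontr)
    assume "z \<notin> convex_cone hull S"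
    moreover have "closed (convex_cone hull S)"
      by (rule closed_convex_cone_hull) (simp add: S_def)
    ultimately obtain u b where u: "u \<bullet> z < b" "\<And>x. x \<in> convex_cone hull S \<Longrightarrow> b < u \<bullet> x"
      using separating_hyperplane_closed_point[OF convex_convex_cone_hull] by blast
    have "b < 0" using u(2)[OF convex_cone_hull_contains_0] by simp
    \<comment> \<open>A functional bounded below on a cone is nonnegative there: a negative value
      could be scaled to exactly \<open>b\<close>, against the strict bound.\<close>
    have nn: "0 \<le> u \<bullet> x" if "x \<in> convex_cone hull S" for x
    proof (rule ccontr)
      assume neg: "\<not> 0 \<le> u \<bullet> x"
      define c where "c = b / (u \<bullet> x)"
      have "0 \<le> c" using neg \<open>b < 0\<close> unfolding c_def by (simp add: divide_nonpos_neg)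
      then have "b < u \<bullet> (c *\<^sub>R x)"
        using that by (intro u(2) convex_cone_hull_mul)
      then show False using neg by (simp add: c_def)
    qed
    have "- u \<in> lin_cone a I E"
    proof -
      have "a i \<bullet> (- u) \<le> 0" if "i \<in> I" for i
        using nn[of "a i"] that by (simp add: S_def hull_inc inner_commute)
      moreover have "0 \<le> a i \<bullet> (- u)" if "i \<in> I" "i \<in> E" for i
        using nn[of "- a i"] that by (simp add: S_def hull_inc inner_commute)
      ultimately show ?thesis unfolding lin_cone_def by (auto intro: antisym)
    qed
    then have "z \<bullet> (- u) \<le> 0" using z unfolding polar_cone_def by auto
    then show False using u(1) \<open>b < 0\<close> by (simp add: inner_commute)
  qed
  then show ?thesis using hull unfolding C_def by auto
qed

lemma lin_mults_in_polar:
  fixes a :: "'q::finite \<Rightarrow> 'a::euclidean_space"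
  assumes "\<mu> \<in> lin_mults I E"
  shows "(\<Sum>i\<in>UNIV. \<mu> $ i *\<^sub>R a i) \<in> polar_cone (lin_cone a I E)"
  using lin_mults_inner_nonpos[OF assms]
  by (auto simp: polar_cone_def inner_sum_left intro!: sum_nonpos)

text \<open>Homogenization by one extra coordinate: solvability means that the cone cut out by the
  vectors \<open>(a i, b $ i)\<close> has an element with positive last coordinate. Otherwise
  \<open>(0, 1)\<close> is polar to it, and \<open>farkas\<close> gives a multiplier that
  annihilates the \<open>a i\<close> although \<open>\<mu> \<bullet> b = 1\<close>.\<close>

lemma inhomogeneous_farkas:
  fixes a :: "'q::finite \<Rightarrow> 'a::euclidean_space" and b :: "real^'q"
  assumes "\<And>\<mu>. \<mu> \<in> lin_mults I E \<Longrightarrow> (\<Sum>i\<in>UNIV. \<mu> $ i *\<^sub>R a i) = 0 \<Longrightarrow> \<mu> \<bullet> b \<le> 0"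
  shows "\<exists>w. \<forall>i\<in>I. a i \<bullet> w + b $ i \<le> 0 \<and> (i \<in> E \<longrightarrow> a i \<bullet> w + b $ i = 0)"
proof -
  define ab where "ab = (\<lambda>i. (a i, b $ i))"
  have "\<not> (0, 1) \<in> polar_cone (lin_cone ab I E)"
  proof
    assume "(0, 1) \<in> polar_cone (lin_cone ab I E)"
    then obtain \<mu> where \<mu>: "\<mu> \<in> lin_mults I E" "(0, 1) = (\<Sum>i\<in>UNIV. \<mu> $ i *\<^sub>R ab i)"
      using farkas by blast
    have "(\<Sum>i\<in>UNIV. \<mu> $ i *\<^sub>R a i) = 0" "\<mu> \<bullet> b = 1"
      using arg_cong[OF \<mu>(2), of fst] arg_cong[OF \<mu>(2), of snd]
      by (auto simp: ab_def fst_sum snd_sum inner_vec_def)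
    then show False using assms[OF \<mu>(1)] by simp
  qed
  then obtain w \<tau> where w: "(w, \<tau>) \<in> lin_cone ab I E" "\<tau> > 0"
    unfolding polar_cone_def by fastforce
  have "a i \<bullet> (w /\<^sub>R \<tau>) + b $ i = (ab i \<bullet> (w, \<tau>)) / \<tau>" for i
    using w(2) by (simp add: ab_def field_simps)
  then show ?thesis using w
    by (intro exI[of _ "w /\<^sub>R \<tau>"]) (auto simp: lin_cone_def divide_nonpos_pos)
qed

section \<open>Normal graphs, tangent directions and critical cones of polyhedral cones\<close>

definition normal_graph :: "'a::real_inner set \<Rightarrow> ('a \<times> 'a) set" where
  "normal_graph K = {(v, z). v \<in> K \<and> z \<in> polar_cone K \<and> z \<bullet> v = 0}"

lemma tangent_coneE:
  assumes "w \<in> tangent_cone S z"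
  obtains t wk where "\<And>k. t k > (0::real)" "t \<longlonglongrightarrow> 0" "wk \<longlonglongrightarrow> w" "\<And>k. z + t k *\<^sub>R wk k \<in> S"
  using assms unfolding tangent_cone_def by auto

lemma sum_nonpos_eq_0D:
  fixes f :: "'b \<Rightarrow> real"
  assumes "finite A" "\<And>i. i \<in> A \<Longrightarrow> f i \<le> 0" "sum f A = 0" "i \<in> A"
  shows "f i = 0"
  using sum_nonneg_eq_0_iff[of A "\<lambda>i. - f i"] assms by (simp add: sum_negf)

text \<open>\<open>normal_graph\<close> expresses normality to a convex cone by polarity and
  orthogonality. As \<open>z\<close> is nonpositive on \<open>K\<close> and vanishes at
  \<open>v\<close>, its product with every difference quotient of \<open>K\<close> at
  \<open>v\<close> is nonpositive, and this passes to the limit.\<close>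

lemma normal_graph_reg_normal:
  assumes "(v, z) \<in> normal_graph K"
  shows "z \<in> reg_normal K v"
proof -
  have "z \<bullet> u \<le> 0" if u: "u \<in> tangent_cone K v" for u
  proof -
    obtain t uk where t: "\<And>k. t k > (0::real)" "uk \<longlonglongrightarrow> u" "\<And>k. v + t k *\<^sub>R uk k \<in> K"
      using tangent_coneE[OF u] by metis
    have "z \<bullet> uk k \<le> 0" for k
    proof -
      have "z \<bullet> (v + t k *\<^sub>R uk k) \<le> 0"
        using assms t(3)[of k] by (auto simp: normal_graph_def polar_cone_def)
      then show ?thesis using assms t(1)[of k]
        by (auto simp: normal_graph_def inner_add_right mult_le_0_iff)
    qed
    moreover have "(\<lambda>k. z \<bullet> uk k) \<longlonglongrightarrow> z \<bullet> u" by (intro tendsto_intros t)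
    ultimately show ?thesis by (simp add: LIMSEQ_le_const2)
  qed
  then show ?thesis using assms by (auto simp: reg_normal_def polar_cone_def normal_graph_def)
qed

lemma closed_normal_graph:
  fixes K :: "'a::real_inner set"
  assumes "closed K"
  shows "closed (normal_graph K)"
proof -
  have "normal_graph K = {p. fst p \<in> K} \<inter> (\<Inter>u\<in>K. {p. snd p \<bullet> u \<le> 0}) \<inter> {p. snd p \<bullet> fst p = 0}"
    by (auto simp: normal_graph_def polar_cone_def)
  moreover have "closed {p::'a\<times>'a. fst p \<in> K}"
    using closed_vimage[OF assms continuous_on_fst[OF continuous_on_id]] by (simp add: vimage_def)
  ultimately show ?thesis
    by (auto intro!: closed_Int closed_INT closed_Collect_le closed_Collect_eq continuous_intros)
qed

lemma closed_lin_cone: "closed (lin_cone a I E)"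
proof -
  have "lin_cone a I E = (\<Inter>i\<in>I. {v. a i \<bullet> v \<le> 0}) \<inter> (\<Inter>i\<in>I\<inter>E. {v. a i \<bullet> v = 0})"
    by (auto simp: lin_cone_def)
  then show ?thesis
    by (auto intro!: closed_Int closed_INT closed_Collect_le closed_Collect_eq continuous_intros)
qed

lemma tangent_coneI_sequentially:
  assumes "\<And>k. t k > (0::real)" "t \<longlonglongrightarrow> 0" "wk \<longlonglongrightarrow> w"
    and "eventually (\<lambda>k. z + t k *\<^sub>R wk k \<in> S) sequentially"
  shows "w \<in> tangent_cone S z"
proof -
  obtain N where N: "\<And>k. k \<ge> N \<Longrightarrow> z + t k *\<^sub>R wk k \<in> S"
    using assms(4) unfolding eventually_sequentially by blast
  have "(\<lambda>k. t (k + N)) \<longlonglongrightarrow> 0" "(\<lambda>k. wk (k + N)) \<longlonglongrightarrow> w"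
    using assms(2,3) by (auto intro: LIMSEQ_ignore_initial_segment)
  then show ?thesis
    unfolding tangent_cone_def using assms(1) N
    by (auto intro!: exI[of _ "\<lambda>k. t (k + N)"] exI[of _ "\<lambda>k. wk (k + N)"])
qed

lemma tangent_coneI_ray:
  assumes "\<tau>0 > 0" "\<And>\<tau>. 0 < \<tau> \<Longrightarrow> \<tau> \<le> \<tau>0 \<Longrightarrow> z + \<tau> *\<^sub>R w \<in> S"
  shows "w \<in> tangent_cone S z"
proof (rule tangent_coneI_sequentially)
  show "\<And>k. \<tau>0 / real (Suc k) > 0" using assms by simp
  show "(\<lambda>k. \<tau>0 / real (Suc k)) \<longlonglongrightarrow> 0"
    using tendsto_mult[OF tendsto_const[of \<tau>0] LIMSEQ_inverse_real_of_nat] by (simp add: field_simps)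
  show "eventually (\<lambda>k. z + (\<tau>0 / real (Suc k)) *\<^sub>R w \<in> S) sequentially"
    using assms by (intro always_eventually allI assms(2)) (auto simp: field_simps)
qed simp

text \<open>Inactive constraints stay strict for short steps and active ones keep the sign
  prescribed for \<open>u\<close>; as there are finitely many, one step length serves for
  all.\<close>

lemma lin_cone_ray:
  fixes a :: "'q::finite \<Rightarrow> 'a::euclidean_space"
  assumes v: "v \<in> lin_cone a I E"
    and u: "\<And>i. i \<in> I \<Longrightarrow> a i \<bullet> v = 0 \<Longrightarrow> a i \<bullet> u \<le> 0 \<and> (i \<in> E \<longrightarrow> a i \<bullet> u = 0)"
  shows "\<exists>\<tau>0>0. \<forall>\<tau>. 0 < \<tau> \<longrightarrow> \<tau> \<le> \<tau>0 \<longrightarrow> v + \<tau> *\<^sub>R u \<in> lin_cone a I E"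
proof -
  have "eventually (\<lambda>\<tau>. \<forall>i\<in>I. a i \<bullet> (v + \<tau> *\<^sub>R u) \<le> 0 \<and> (i \<in> E \<longrightarrow> a i \<bullet> (v + \<tau> *\<^sub>R u) = 0)) (at_right 0)"
  proof (intro eventually_ball_finite ballI)
    fix i assume i: "i \<in> I"
    show "eventually (\<lambda>\<tau>. a i \<bullet> (v + \<tau> *\<^sub>R u) \<le> 0 \<and> (i \<in> E \<longrightarrow> a i \<bullet> (v + \<tau> *\<^sub>R u) = 0)) (at_right 0)"
    proof (cases "a i \<bullet> v = 0")
      case True
      then show ?thesis using u[OF i True]
        by (auto simp: eventually_at_right_field inner_add_right mult_nonneg_nonpos intro!: exI[of _ 1])
    next
      case False
      then have neg: "a i \<bullet> v < 0" "i \<notin> E" using v i by (fastforce simp: lin_cone_def)+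
      have "((\<lambda>\<tau>. a i \<bullet> (v + \<tau> *\<^sub>R u)) \<longlongrightarrow> a i \<bullet> (v + 0 *\<^sub>R u)) (at_right 0)"
        by (intro tendsto_intros)
      then have "eventually (\<lambda>\<tau>. a i \<bullet> (v + \<tau> *\<^sub>R u) < 0) (at_right 0)"
        using neg by (intro order_tendstoD) auto
      then show ?thesis by eventually_elim (use neg in auto)
    qed
  qed simp
  then obtain b where "b > 0" "\<And>\<tau>. 0 < \<tau> \<Longrightarrow> \<tau> < b \<Longrightarrow> v + \<tau> *\<^sub>R u \<in> lin_cone a I E"
    by (auto simp: eventually_at_right_field lin_cone_def)
  then show ?thesis by (intro exI[of _ "b / 2"]) auto
qed

text \<open>Complementary slackness: all products of \<open>\<mu> $ i\<close> with
  \<open>a i \<bullet> v\<close> vanish, so \<open>\<mu>\<close> is carried by active indices. For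
  tangent \<open>u\<close> orthogonal to \<open>z\<close> the same sign argument makes each term of
  \<open>z \<bullet> u\<close> vanish, which turns positive multipliers into equalities. Conversely,
  such \<open>u\<close> are feasible directions by \<open>lin_cone_ray\<close>.\<close>

lemma crit_cone_lin_cone:
  fixes a :: "'q::finite \<Rightarrow> 'a::euclidean_space"
  assumes v: "v \<in> lin_cone a I E" and \<mu>: "\<mu> \<in> lin_mults I E"
    and z: "z = (\<Sum>i\<in>UNIV. \<mu> $ i *\<^sub>R a i)" and zv: "z \<bullet> v = 0"
  shows "crit_cone (lin_cone a I E) v z
         = lin_cone a {i\<in>I. a i \<bullet> v = 0} {i. i \<in> E \<or> \<mu> $ i > 0}" (is "?L = ?R")
proof -
  have "(\<Sum>i\<in>UNIV. \<mu> $ i * (a i \<bullet> v)) = 0"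
    using zv z by (simp add: inner_sum_left)
  then have compl: "\<mu> $ i * (a i \<bullet> v) = 0" for i
    by (rule sum_nonpos_eq_0D[rotated 2]) (auto intro: lin_mults_inner_nonpos[OF \<mu> v])
  have zu: "z \<bullet> u = (\<Sum>i\<in>UNIV. \<mu> $ i * (a i \<bullet> u))" for u
    using z by (simp add: inner_sum_left)
  show ?thesis
  proof (intro equalityI subsetI)
    fix u assume "u \<in> ?L"
    then have "u \<in> tangent_cone (lin_cone a I E) v" and zu0: "z \<bullet> u = 0"
      unfolding crit_cone_def by auto
    then obtain t uk where t: "\<And>k. t k > (0::real)" "uk \<longlonglongrightarrow> u"
        "\<And>k. v + t k *\<^sub>R uk k \<in> lin_cone a I E"
      using tangent_coneE by metis
    have lim: "(\<lambda>k. a i \<bullet> uk k) \<longlonglongrightarrow> a i \<bullet> u" for i by (intro tendsto_intros t)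
    have le: "a i \<bullet> u \<le> 0" if i: "i \<in> I" "a i \<bullet> v = 0" for i
    proof -
      have "a i \<bullet> uk k \<le> 0" for k
      proof -
        have "a i \<bullet> (v + t k *\<^sub>R uk k) \<le> 0" using t(3)[of k] i by (simp add: lin_cone_def)
        then show ?thesis using t(1)[of k] i by (auto simp: inner_add_right mult_le_0_iff)
      qed
      then show ?thesis using lim[of i] by (simp add: LIMSEQ_le_const2)
    qed
    have eq: "a i \<bullet> u = 0" if i: "i \<in> I" "i \<in> E" for i
    proof -
      have "a i \<bullet> uk k = 0" for k
      proof -
        have "a i \<bullet> (v + t k *\<^sub>R uk k) = 0" "a i \<bullet> v = 0"
          using t(3)[of k] i v by (auto simp: lin_cone_def)
        then show ?thesis using t(1)[of k] i by (auto simp: inner_add_right)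
      qed
      then show ?thesis using lim[of i] by (simp add: LIMSEQ_const_iff)
    qed
    have terms: "\<mu> $ i * (a i \<bullet> u) \<le> 0" for i
    proof (cases "i \<in> E \<or> \<mu> $ i = 0")
      case True
      then show ?thesis using eq[of i] \<mu> by (cases "i \<in> I") (auto simp: lin_mults_def)
    next
      case False
      then have "i \<in> I" "a i \<bullet> v = 0" "\<mu> $ i \<ge> 0"
        using compl[of i] \<mu> by (auto simp: lin_mults_def)
      then show ?thesis using le[of i] by (simp add: mult_nonneg_nonpos)
    qed
    have "\<mu> $ i * (a i \<bullet> u) = 0" for i
      by (rule sum_nonpos_eq_0D[of UNIV]) (use zu0 zu[of u] terms in auto)
    then have "a i \<bullet> u = 0" if "\<mu> $ i > 0" for i using that by (metis less_irrefl mult_eq_0_iff)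
    then show "u \<in> ?R" using le eq by (auto simp: lin_cone_def)
  next
    fix u assume u: "u \<in> ?R"
    then have "\<exists>\<tau>0>0. \<forall>\<tau>. 0 < \<tau> \<longrightarrow> \<tau> \<le> \<tau>0 \<longrightarrow> v + \<tau> *\<^sub>R u \<in> lin_cone a I E"
      by (intro lin_cone_ray[OF v]) (auto simp: lin_cone_def)
    then have "u \<in> tangent_cone (lin_cone a I E) v"
      using tangent_coneI_ray by blast
    moreover have terms: "\<mu> $ i * (a i \<bullet> u) = 0" for i
    proof (cases "\<mu> $ i = 0")
      case False
      then have "i \<in> I" "a i \<bullet> v = 0" "i \<in> E \<or> \<mu> $ i > 0"
        using compl[of i] \<mu> by (auto simp: lin_mults_def order_less_le)
      then show ?thesis using u by (auto simp: lin_cone_def)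
    qed simp
    moreover have "z \<bullet> u = 0" unfolding zu by (intro sum.neutral ballI terms)
    ultimately show "u \<in> ?L" by (simp add: crit_cone_def)
  qed
qed

text \<open>Each critical cone is determined by two subsets of the finite index type.\<close>

lemma finite_crit_cones:
  fixes a :: "'q::finite \<Rightarrow> 'a::euclidean_space"
  shows "finite ((\<lambda>(v, z). crit_cone (lin_cone a I E) v z) ` normal_graph (lin_cone a I E))"
proof (rule finite_subset)
  show "(\<lambda>(v, z). crit_cone (lin_cone a I E) v z) ` normal_graph (lin_cone a I E)
        \<subseteq> (\<lambda>(I, E). lin_cone a I E) ` UNIV"
  proof clarify
    fix v z assume vz: "(v, z) \<in> normal_graph (lin_cone a I E)"
    then obtain \<mu> where "\<mu> \<in> lin_mults I E" "z = (\<Sum>i\<in>UNIV. \<mu> $ i *\<^sub>R a i)"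
      using farkas by (fastforce simp: normal_graph_def)
    then show "crit_cone (lin_cone a I E) v z \<in> range (\<lambda>(I, E). lin_cone a I E)"
      using crit_cone_lin_cone vz by (force simp: normal_graph_def)
  qed
qed simp

text \<open>Testing only directions along which a whole segment stays in \<open>T\<close> may give
  more than the polar of the tangent cone, but such segments are easy to exhibit when
  \<open>T\<close> is made of polyhedral pieces.\<close>

definition radial_normals :: "'a::real_inner set \<Rightarrow> 'a \<Rightarrow> 'a set" where
  "radial_normals T t = {\<zeta>. \<forall>d \<tau>0. \<tau>0 > 0 \<longrightarrow> (\<forall>\<tau>. 0 < \<tau> \<longrightarrow> \<tau> \<le> \<tau>0 \<longrightarrow> t + \<tau> *\<^sub>R d \<in> T) \<longrightarrow> \<zeta> \<bullet> d \<le> 0}"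

lemma radial_normalsD:
  assumes "\<zeta> \<in> radial_normals T t" "\<tau>0 > 0" "\<And>\<tau>. 0 < \<tau> \<Longrightarrow> \<tau> \<le> \<tau>0 \<Longrightarrow> t + \<tau> *\<^sub>R d \<in> T"
  shows "\<zeta> \<bullet> d \<le> 0"
  using assms unfolding radial_normals_def by blast

text \<open>Two families of segments suffice. Moving \<open>v\<close> along a critical direction
  with \<open>z\<close> fixed gives the condition on \<open>p\<close>; moving \<open>z\<close> by
  multiples of the active \<open>a i\<close> with \<open>v\<close> fixed gives the inequalities and
  equalities of the critical cone for \<open>\<beta>\<close>.\<close>

lemma radial_normals_normal_graph:
  fixes a :: "'q::finite \<Rightarrow> 'a::euclidean_space" and I E :: "'q set"
  defines "K \<equiv> lin_cone a I E"
  assumes vz: "(v, z) \<in> normal_graph K"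
    and N: "(p, \<beta>) \<in> radial_normals (normal_graph K) (v, z)"
  shows "p \<in> polar_cone (crit_cone K v z) \<and> \<beta> \<in> crit_cone K v z"
proof -
  obtain \<mu> where \<mu>: "\<mu> \<in> lin_mults I E" and z: "z = (\<Sum>i\<in>UNIV. \<mu> $ i *\<^sub>R a i)"
    using vz farkas by (fastforce simp: normal_graph_def K_def)
  have v: "v \<in> lin_cone a I E" and zv: "z \<bullet> v = 0" and zK: "\<And>u. u \<in> K \<Longrightarrow> z \<bullet> u \<le> 0"
    using vz by (auto simp: normal_graph_def K_def polar_cone_def)
  note crit = crit_cone_lin_cone[OF v \<mu> z zv, folded K_def]
  have N': "p \<bullet> d + \<beta> \<bullet> e \<le> 0"
    if "\<tau>0 > 0" "\<And>\<tau>. 0 < \<tau> \<Longrightarrow> \<tau> \<le> \<tau>0 \<Longrightarrow> (v + \<tau> *\<^sub>R d, z + \<tau> *\<^sub>R e) \<in> normal_graph K" for d e \<tau>0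
  proof -
    have "(p, \<beta>) \<bullet> (d, e) \<le> 0"
      by (rule radial_normalsD[OF N \<open>\<tau>0 > 0\<close>]) (simp add: that(2))
    then show ?thesis by simp
  qed
  have "p \<bullet> u \<le> 0" if u: "u \<in> crit_cone K v z" for u
  proof -
    have "\<exists>\<tau>0>0. \<forall>\<tau>. 0 < \<tau> \<longrightarrow> \<tau> \<le> \<tau>0 \<longrightarrow> v + \<tau> *\<^sub>R u \<in> K"
      unfolding K_def using u[unfolded crit] by (intro lin_cone_ray[OF v]) (auto simp: lin_cone_def)
    then obtain \<tau>0 where "\<tau>0 > 0" "\<And>\<tau>. 0 < \<tau> \<Longrightarrow> \<tau> \<le> \<tau>0 \<Longrightarrow> v + \<tau> *\<^sub>R u \<in> K"
      by blast
    moreover have "z \<bullet> u = 0" using u by (simp add: crit_cone_def)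
    ultimately have "p \<bullet> u + \<beta> \<bullet> 0 \<le> 0"
      using vz by (intro N') (auto simp: normal_graph_def inner_add_right)
    then show ?thesis by simp
  qed
  moreover have "\<beta> \<in> lin_cone a {i\<in>I. a i \<bullet> v = 0} {i. i \<in> E \<or> \<mu> $ i > 0}"
  proof -
    have "a i \<bullet> \<beta> \<le> 0" if i: "i \<in> I" "a i \<bullet> v = 0" for i
    proof -
      have "p \<bullet> 0 + \<beta> \<bullet> a i \<le> 0"
        using vz i by (intro N'[of 1])
          (auto simp: normal_graph_def inner_add_left polar_cone_def K_def lin_cone_def
                intro!: add_nonpos_nonpos mult_nonneg_nonpos)
      then show ?thesis by (simp add: inner_commute)
    qed
    moreover have "0 \<le> a i \<bullet> \<beta>" if i: "i \<in> I" "a i \<bullet> v = 0" "i \<in> E \<or> \<mu> $ i > 0" for i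
    proof -
      \<comment> \<open>Subtracting \<open>\<tau>\<close> from the \<open>i\<close>-th multiplier
        keeps it admissible at any length when its sign is free; otherwise the multiplier must stay
        nonnegative.\<close>
      define \<tau>0 where "\<tau>0 = (if i \<in> E then 1 else \<mu> $ i)"
      have "z - \<tau> *\<^sub>R a i \<in> polar_cone K" if \<tau>: "0 < \<tau>" "\<tau> \<le> \<tau>0" for \<tau>
      proof -
        have "z - \<tau> *\<^sub>R a i = (\<Sum>j\<in>UNIV. (\<mu> - axis i \<tau>) $ j *\<^sub>R a j)"
          by (simp add: z scaleR_diff_left sum_subtractf axis_def
                if_distrib[of "\<lambda>x. x *\<^sub>R _"] cong: if_cong)
        moreover have "\<mu> - axis i \<tau> \<in> lin_mults I E"
          using \<mu> i \<tau> by (auto simp: lin_mults_def axis_def \<tau>0_def split: if_splits)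
        ultimately show ?thesis using lin_mults_in_polar[of "\<mu> - axis i \<tau>" I E a]
          unfolding K_def by (simp only:)
      qed
      then have "p \<bullet> 0 + \<beta> \<bullet> (- a i) \<le> 0"
        using i v zv by (intro N'[of \<tau>0]) (auto simp: normal_graph_def inner_diff_left K_def \<tau>0_def)
      then show ?thesis by (simp add: inner_commute)
    qed
    ultimately show ?thesis by (fastforce simp: lin_cone_def)
  qed
  ultimately show ?thesis using crit by (auto simp: polar_cone_def)
qed

section \<open>Multipliers for conic systems\<close>

text \<open>\<open>\<zeta>\<close> is the scaled residual of a quadratically penalized problem.
  Minimality in \<open>t\<close> makes it a radial normal, minimality in \<open>z\<close> gives the
  equation, and comparison with the origin combined with \<open>pen\<close> gives the norm
  estimates, of which the one for \<open>\<zeta>\<close> does not depend on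
  \<open>e\<close>.\<close>

lemma penalized_multiplier_approx:
  fixes A :: "'z::euclidean_space \<Rightarrow> 't::euclidean_space"
  assumes lin: "linear A" and cl: "closed T" and "0 \<in> T" and "C \<ge> 0" and e: "e > 0"
    and pen: "\<And>z t. t \<in> T \<Longrightarrow> - C * norm (A z - t) \<le> f \<bullet> z"
  shows "\<exists>t\<in>T. \<exists>\<zeta>\<in>radial_normals T t. \<exists>z. norm \<zeta> \<le> 2 * C \<and> norm z \<le> 2 * C * e
           \<and> (\<forall>h. (f + z) \<bullet> h + \<zeta> \<bullet> A h = 0)"
proof -
  \<comment> \<open>With \<open>r = (A z - t) / e\<close>, the point of \<open>X\<close> closest to \<open>(- f, 0)\<close> minimizes
    \<open>f \<bullet> z + |z|\<^sup>2 / 2 + |A z - t|\<^sup>2 / (2 e\<^sup>2)\<close> over all \<open>z\<close> and \<open>t \<in> T\<close>.\<close>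
  define X where "X = {p. A (fst p) - e *\<^sub>R snd p \<in> T}"
  have contA: "continuous_on UNIV A" using lin by (simp add: linear_continuous_on linear_conv_bounded_linear)
  have "closed X"
  proof -
    have "continuous_on UNIV (\<lambda>p::'z\<times>'t. A (fst p) - e *\<^sub>R snd p)"
      by (intro continuous_intros continuous_on_compose2[OF contA]) auto
    then show ?thesis
      using closed_vimage[OF cl] unfolding X_def vimage_def by blast
  qed
  moreover have X0: "(0, 0) \<in> X" using \<open>0 \<in> T\<close> by (simp add: X_def linear_0[OF lin])
  ultimately obtain z r where zr: "(z, r) \<in> X"
    and min: "\<And>p. p \<in> X \<Longrightarrow> dist (- f, 0) (z, r) \<le> dist (- f, 0) p"
    using distance_attains_inf[of X "(- f, 0)"] by (metis empty_iff surj_pair)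
  have min2: "(f + z) \<bullet> (f + z) + r \<bullet> r \<le> (f + z') \<bullet> (f + z') + r' \<bullet> r'" if "(z', r') \<in> X" for z' r'
  proof -
    have "(norm ((- f, 0) - (z, r)))\<^sup>2 \<le> (norm ((- f, 0) - (z', r')))\<^sup>2"
      using min[OF that] by (simp add: dist_norm power_mono)
    then show ?thesis
      by (simp add: power2_norm_eq_inner inner_add_left inner_add_right inner_diff_left
          inner_diff_right inner_commute)
  qed
  define t where "t = A z - e *\<^sub>R r"
  define \<zeta> where "\<zeta> = r /\<^sub>R e"
  have t: "t \<in> T" using zr by (simp add: X_def t_def)
  \<comment> \<open>A linear term dominated by a quadratic one on short steps cannot be positive;
    \<open>\<tau>\<close> is taken so small that the quadratic term accounts for at most half of
    \<open>b\<close>.\<close>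
  have quad: "b \<le> 0" if "\<tau>0 > 0" "\<And>\<tau>. 0 < \<tau> \<Longrightarrow> \<tau> \<le> \<tau>0 \<Longrightarrow> \<tau> * b \<le> \<tau> * \<tau> * c" for b c \<tau>0 :: real
  proof (rule ccontr)
    assume "\<not> b \<le> 0"
    then have b: "b > 0" by simp
    define \<tau> where "\<tau> = min \<tau>0 (b / (2 * (\<bar>c\<bar> + 1)))"
    have \<tau>: "0 < \<tau>" "\<tau> \<le> \<tau>0" using that(1) b by (auto simp: \<tau>_def)
    have "b \<le> \<tau> * c" using that(2)[OF \<tau>] \<tau> by (simp add: mult.assoc)
    also have "\<dots> \<le> \<tau> * (\<bar>c\<bar> + 1)" using \<tau> by (intro mult_left_mono) auto
    also have "\<dots> \<le> b / (2 * (\<bar>c\<bar> + 1)) * (\<bar>c\<bar> + 1)" by (intro mult_right_mono) (auto simp: \<tau>_def)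
    also have "\<dots> = b / 2" by (simp add: field_simps)
    finally show False using b by simp
  qed
  have "\<zeta> \<in> radial_normals T t"
    unfolding radial_normals_def
  proof (intro CollectI allI impI)
    fix d and \<tau>0 :: real
    assume \<tau>0: "\<tau>0 > 0" and dir: "\<forall>\<tau>. 0 < \<tau> \<longrightarrow> \<tau> \<le> \<tau>0 \<longrightarrow> t + \<tau> *\<^sub>R d \<in> T"
    have "2 * (\<zeta> \<bullet> d) \<le> 0"
    proof (rule quad[OF \<tau>0])
      fix \<tau> assume \<tau>: "0 < \<tau>" "\<tau> \<le> \<tau>0"
      \<comment> \<open>With \<open>z\<close> fixed, this change of \<open>r\<close> moves
        \<open>t\<close> by exactly \<open>\<tau> *\<^sub>R d\<close>.\<close>
      have "(z, r - (\<tau> / e) *\<^sub>R d) \<in> X"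
        using dir \<tau> e by (simp add: X_def t_def algebra_simps)
      from min2[OF this] have "0 \<le> - 2 * (\<tau> / e) * (r \<bullet> d) + (\<tau> / e) * (\<tau> / e) * (d \<bullet> d)"
        by (simp add: inner_diff_left inner_diff_right inner_commute algebra_simps)
      then show "\<tau> * (2 * (\<zeta> \<bullet> d)) \<le> \<tau> * \<tau> * ((d \<bullet> d) / (e * e))"
        using e by (simp add: \<zeta>_def field_simps)
    qed
    then show "\<zeta> \<bullet> d \<le> 0" by simp
  qed
  moreover have "(f + z) \<bullet> h + \<zeta> \<bullet> A h = 0" for h
  proof -
    have le: "- (2 * ((f + z) \<bullet> h + \<zeta> \<bullet> A h)) \<le> 0" for h
    proof (rule quad[of 1])
      fix \<tau> :: real assume \<tau>: "0 < \<tau>" "\<tau> \<le> 1"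
      \<comment> \<open>The change of \<open>r\<close> compensates that of \<open>z\<close>, so
        \<open>t\<close> stays fixed and \<open>h\<close> may have either sign.\<close>
      have "(z + \<tau> *\<^sub>R h, r + (\<tau> / e) *\<^sub>R A h) \<in> X"
        using t e by (simp add: X_def t_def algebra_simps linear_add[OF lin] linear_scale[OF lin])
      from min2[OF this]
      show "\<tau> * - (2 * ((f + z) \<bullet> h + \<zeta> \<bullet> A h)) \<le> \<tau> * \<tau> * (h \<bullet> h + (A h \<bullet> A h) / (e * e))"
        using e by (simp add: \<zeta>_def inner_add_left inner_add_right inner_commute field_simps)
    qed simp
    show ?thesis using le[of h] le[of "- h"] by (simp add: linear_neg[OF lin])
  qed
  moreover have "norm \<zeta> \<le> 2 * C \<and> norm z \<le> 2 * C * e"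
  proof -
    have "f \<bullet> z \<ge> - C * (e * norm r)" using pen[OF t, of z] e by (simp add: t_def)
    moreover have "(f + z) \<bullet> (f + z) + r \<bullet> r \<le> f \<bullet> f" using min2[OF X0] by simp
    moreover have "(f + z) \<bullet> (f + z) = f \<bullet> f + 2 * (f \<bullet> z) + z \<bullet> z"
      by (simp add: inner_add_left inner_add_right inner_commute)
    \<comment> \<open>This forces \<open>norm r\<close> to be at most \<open>2 * C * e\<close>.
      Dividing by \<open>e\<close> bounds \<open>\<zeta>\<close>, and inserting the bound again
      controls \<open>z\<close>.\<close>
    ultimately have "z \<bullet> z + r \<bullet> r \<le> 2 * (C * (e * norm r))" by simp
    then have *: "norm z * norm z + norm r * norm r \<le> 2 * C * e * norm r"
      by (simp add: power2_norm_eq_inner[symmetric] power2_eq_square mult.assoc)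
    moreover have "0 \<le> norm z * norm z" "0 \<le> norm r * norm r" by simp_all
    ultimately have "norm r * norm r \<le> 2 * C * e * norm r" by linarith
    then have r: "norm r \<le> 2 * C * e"
      using \<open>C \<ge> 0\<close> e by (cases "norm r = 0") auto
    have "norm z * norm z \<le> 2 * C * e * norm r"
      using * \<open>0 \<le> norm r * norm r\<close> by linarith
    also have "\<dots> \<le> 2 * C * e * (2 * C * e)"
      using r \<open>C \<ge> 0\<close> e by (intro mult_left_mono) auto
    finally have "norm z \<le> 2 * C * e"
      using \<open>C \<ge> 0\<close> e by - (rule power2_le_imp_le, auto simp: power2_eq_square)
    moreover have "norm \<zeta> \<le> 2 * C" using r e by (simp add: \<zeta>_def field_simps)
    ultimately show ?thesis by simp
  qed
  ultimately show ?thesis using t by blast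
qed

text \<open>The approximate multipliers lie in a ball intersected with a finite union of closed
  sets, which is compact. Its image under the negative adjoint is closed and contains
  \<open>f + z\<close> for arbitrarily small \<open>z\<close>, hence \<open>f\<close> itself. Only
  the set \<open>N t\<close>, not the point \<open>t\<close>, has to survive the limit.\<close>

lemma penalized_multiplier:
  fixes A :: "'z::euclidean_space \<Rightarrow> 't::euclidean_space"
  assumes lin: "linear A" and cl: "closed T" and T0: "0 \<in> T" and C: "C \<ge> 0"
    and pen: "\<And>z t. t \<in> T \<Longrightarrow> - C * norm (A z - t) \<le> f \<bullet> z"
    and normals: "\<And>t. t \<in> T \<Longrightarrow> radial_normals T t \<subseteq> N t"
    and fin: "finite (N ` T)" and clN: "\<And>t. t \<in> T \<Longrightarrow> closed (N t)"
  shows "\<exists>t\<in>T. \<exists>\<zeta>\<in>N t. \<forall>h. f \<bullet> h + \<zeta> \<bullet> A h = 0"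
proof -
  define B where "B = (\<lambda>\<zeta>. - adjoint A \<zeta>) ` (\<Union>(N ` T) \<inter> cball 0 (2 * C))"
  have adj: "\<zeta> \<bullet> A h = adjoint A \<zeta> \<bullet> h" for \<zeta> h by (simp add: adjoint_clauses[OF lin])
  have "closed (\<Union>(N ` T))" using fin clN by (intro closed_Union) auto
  then have "compact (\<Union>(N ` T) \<inter> cball 0 (2 * C))" by (rule closed_Int_compact) simp
  moreover have "continuous_on S (\<lambda>\<zeta>. - adjoint A \<zeta>)" for S
    using adjoint_linear[OF lin]
    by (intro continuous_intros linear_continuous_on) (simp add: linear_conv_bounded_linear)
  ultimately have "closed B" unfolding B_def by (intro compact_imp_closed compact_continuous_image)
  have "f \<in> closure B"
    unfolding closure_approachable
  proof (intro allI impI)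
    fix e :: real assume "e > 0"
    \<comment> \<open>The summand \<open>1\<close> keeps the quotient meaningful for
      \<open>C = 0\<close> and makes \<open>2 * C * e'\<close> strictly less than
      \<open>e\<close>.\<close>
    define e' where "e' = e / (2 * C + 1)"
    have "e' > 0" using \<open>e > 0\<close> C by (simp add: e'_def)
    from penalized_multiplier_approx[OF lin cl T0 C this pen]
    obtain t \<zeta> z where t: "t \<in> T" and \<zeta>: "\<zeta> \<in> radial_normals T t" "norm \<zeta> \<le> 2 * C"
      and z: "norm z \<le> 2 * C * e'" and eq: "\<And>h. (f + z) \<bullet> h + \<zeta> \<bullet> A h = 0" by blast
    have "(f + z + adjoint A \<zeta>) \<bullet> h = 0" for h
      using eq[of h] by (simp add: adj inner_add_left)
    then have "f + z = - adjoint A \<zeta>" by (metis inner_eq_zero_iff eq_neg_iff_add_eq_0)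
    moreover have "\<zeta> \<in> \<Union>(N ` T) \<inter> cball 0 (2 * C)" using t \<zeta> normals[OF t] by auto
    ultimately have "f + z \<in> B" unfolding B_def by (rule image_eqI)
    moreover have "norm z < e"
    proof -
      have "2 * C * e' < (2 * C + 1) * e'" using \<open>e' > 0\<close> by simp
      also have "\<dots> = e" using C by (simp add: e'_def)
      finally show ?thesis using z by simp
    qed
    ultimately show "\<exists>y\<in>B. dist y f < e" by (auto simp: dist_norm intro!: bexI[of _ "f + z"])
  qed
  then have "f \<in> B" using \<open>closed B\<close> by simp
  then obtain t \<zeta> where "t \<in> T" "\<zeta> \<in> N t" "f = - adjoint A \<zeta>" unfolding B_def by auto
  then show ?thesis by (intro bexI[of _ t] bexI[of _ \<zeta>]) (auto simp: adj inner_minus_left)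
qed

text \<open>\<open>f\<close> is nonnegative on the solution set \<open>L\<close> of the linearized
  system, so it is bounded below by \<open>- norm f\<close> times the distance to \<open>L\<close>,
  which subregularity estimates by the residual. This is local; since \<open>T'\<close> is conic,
  shrinking \<open>z\<close> and \<open>t\<close> together makes it global.\<close>

lemma subregular_cone_penalty:
  fixes A :: "'z::euclidean_space \<Rightarrow> 't::euclidean_space"
  assumes lin: "linear A"
    and sub: "metric_subregular (\<lambda>z. {A z - t | t. t \<in> T}) 0 0"
    and cone: "conic T'" and T': "T' \<subseteq> T"
    and f: "\<And>z. A z \<in> T \<Longrightarrow> 0 \<le> f \<bullet> z"
  shows "\<exists>C\<ge>0. \<forall>z. \<forall>t\<in>T'. - C * norm (A z - t) \<le> f \<bullet> z"
proof -
  define L where "L = {z. A z \<in> T}"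
  have L: "{z'. 0 \<in> {A z' - t | t. t \<in> T}} = L" unfolding L_def by auto
  obtain W \<kappa> where W: "open W" "0 \<in> W" and \<kappa>: "\<kappa> > 0"
    and sub': "\<And>z. z \<in> W \<Longrightarrow> {A z - t | t. t \<in> T} \<noteq> {} \<Longrightarrow> infdist z L \<le> \<kappa> * infdist 0 {A z - t | t. t \<in> T}"
    and 0: "0 \<in> L"
    using sub unfolding metric_subregular_def L gph_def by (auto simp: L_def)
  obtain \<delta> where \<delta>: "\<delta> > 0" "ball 0 \<delta> \<subseteq> W" using W openE by blast
  have loc: "- (norm f * \<kappa>) * norm (A z - t) \<le> f \<bullet> z" if "z \<in> W" "t \<in> T" for z t
  proof -
    have "infdist z L \<le> \<kappa> * infdist 0 {A z - t | t. t \<in> T}" using that by (intro sub') auto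
    also have "\<dots> \<le> \<kappa> * norm (A z - t)"
      using \<kappa> infdist_le[of "A z - t" "{A z - t | t. t \<in> T}" 0] that by (intro mult_left_mono) auto
    finally have 1: "infdist z L \<le> \<kappa> * norm (A z - t)" .
    have "- (f \<bullet> z) \<le> norm f * dist z l" if "l \<in> L" for l
    proof -
      have "- (f \<bullet> z) \<le> f \<bullet> (l - z)" using f[of l] that by (simp add: L_def inner_diff_right)
      also have "\<dots> \<le> norm f * dist z l" by (metis dist_commute dist_norm norm_cauchy_schwarz)
      finally show ?thesis .
    qed
    then have "- (f \<bullet> z) \<le> norm f * infdist z L"
    proof (cases "norm f = 0")
      case False
      then have pos: "norm f > 0" by simp
      have "- (f \<bullet> z) / norm f \<le> infdist z L"
        unfolding infdist_notempty[OF ex_in_conv[THEN iffD1, OF exI[of _ 0], OF 0]]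
        using \<open>\<And>l. l \<in> L \<Longrightarrow> - (f \<bullet> z) \<le> norm f * dist z l\<close> 0 pos
        by (intro cINF_greatest) (auto simp: field_simps)
      then show ?thesis using pos by (simp add: field_simps)
    qed simp
    also have "\<dots> \<le> norm f * (\<kappa> * norm (A z - t))" using 1 by (intro mult_left_mono) auto
    finally show ?thesis by simp
  qed
  have "- (norm f * \<kappa>) * norm (A z - t) \<le> f \<bullet> z" if t: "t \<in> T'" for z t
  proof -
    define \<tau> where "\<tau> = \<delta> / (2 * (norm z + 1))"
    have \<tau>: "\<tau> > 0" using \<delta>(1) by (simp add: \<tau>_def add_nonneg_pos)
    have "\<tau> * norm z < \<delta>"
    proof -
      have "\<tau> * norm z \<le> \<tau> * (norm z + 1)" using \<tau> by simp
      also have "\<dots> = \<delta> / 2" by (simp add: \<tau>_def divide_simps) (smt (verit) norm_ge_zero)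
      finally show ?thesis using \<delta>(1) by simp
    qed
    then have "\<tau> *\<^sub>R z \<in> W" using \<tau> \<delta>(2) by (auto simp: mem_ball_0)
    moreover have "\<tau> *\<^sub>R t \<in> T" using t cone \<tau> T' by (auto simp: conic_def)
    ultimately have "- (norm f * \<kappa>) * norm (A (\<tau> *\<^sub>R z) - \<tau> *\<^sub>R t) \<le> f \<bullet> (\<tau> *\<^sub>R z)" by (rule loc)
    moreover have "A (\<tau> *\<^sub>R z) - \<tau> *\<^sub>R t = \<tau> *\<^sub>R (A z - t)"
      by (simp add: linear_scale[OF lin] scaleR_diff_right)
    ultimately have "\<tau> * (- (norm f * \<kappa>) * norm (A z - t)) \<le> \<tau> * (f \<bullet> z)"
      using \<tau> by (simp only: norm_scaleR inner_scaleR_right) (simp add: mult_ac)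
    then show ?thesis using \<tau> by (simp only: mult_le_cancel_left_pos)
  qed
  then show ?thesis using \<kappa> by (intro exI[of _ "norm f * \<kappa>"]) auto
qed

section \<open>Second-order analysis of inequality systems\<close>

lemma inner_ext:
  fixes x y :: "'a::real_inner"
  assumes "\<And>u. x \<bullet> u = y \<bullet> u"
  shows "x = y"
  using assms vector_eq_rdot[of x y] by blast

lemma inner_grad:
  assumes "linear L"
  shows "grad L \<bullet> u = L u"
proof -
  have "L u = L (\<Sum>b\<in>Basis. (u \<bullet> b) *\<^sub>R b)" by (simp add: euclidean_representation)
  also have "\<dots> = (\<Sum>b\<in>Basis. (u \<bullet> b) * L b)"
    by (simp add: linear_sum[OF assms] linear_scale[OF assms])
  also have "\<dots> = grad L \<bullet> u" unfolding grad_def inner_sum_left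
    by (intro sum.cong) (auto simp: inner_commute)
  finally show ?thesis ..
qed

lemma linear_inner_blinfun: "linear (\<lambda>u. l \<bullet> blinfun_apply B u)"
  by (intro linearI) (simp_all add: blinfun.add_right blinfun.scaleR_right inner_add_right)

text \<open>The relative remainder, extended by \<open>0\<close> at the origin so that vanishing
  steps are allowed, is continuous there; along \<open>h\<close> it is multiplied by a convergent
  factor.\<close>

lemma has_derivative_sequence:
  fixes f :: "'a::real_normed_vector \<Rightarrow> 'b::real_normed_vector"
  assumes f: "(f has_derivative f') (at x)"
    and t: "\<And>k. t k > (0::real)" "t \<longlonglongrightarrow> 0" and h: "(\<lambda>k. h k /\<^sub>R t k) \<longlonglongrightarrow> v"
  shows "(\<lambda>k. (f (x + h k) - f x) /\<^sub>R t k) \<longlonglongrightarrow> f' v"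
proof -
  interpret bounded_linear f' using f by (rule has_derivative_bounded_linear)
  define R where "R = (\<lambda>d. if d = 0 then 0 else norm (f (x + d) - f x - f' d) / norm d)"
  have "(\<lambda>d. norm (f (x + d) - f x - f' d) / norm d) \<midarrow>0\<rightarrow> 0"
    using f by (simp add: has_derivative_at)
  then have "R \<midarrow>0\<rightarrow> 0"
    by (rule Lim_transform_eventually) (auto simp: R_def eventually_at_filter)
  then have R: "isCont R 0" by (simp add: isCont_def R_def)
  have "(\<lambda>k. t k *\<^sub>R (h k /\<^sub>R t k)) \<longlonglongrightarrow> 0 *\<^sub>R v" by (intro tendsto_intros t h)
  moreover have tne: "t k \<noteq> 0" for k using t(1)[of k] by simp
  ultimately have "h \<longlonglongrightarrow> 0" by simp
  then have "(\<lambda>k. R (h k)) \<longlonglongrightarrow> 0" using isCont_tendsto_compose[OF R] by (simp add: R_def)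
  then have "(\<lambda>k. R (h k) * norm (h k /\<^sub>R t k)) \<longlonglongrightarrow> 0 * norm v" by (intro tendsto_intros h)
  moreover have "norm ((f (x + h k) - f x) /\<^sub>R t k - f' (h k /\<^sub>R t k)) = R (h k) * norm (h k /\<^sub>R t k)" for k
  proof -
    have "(f (x + h k) - f x) /\<^sub>R t k - f' (h k /\<^sub>R t k) = (f (x + h k) - f x - f' (h k)) /\<^sub>R t k"
      by (simp add: scaleR scaleR_diff_right)
    then show ?thesis using t(1)[of k] by (simp add: R_def zero)
  qed
  ultimately have "(\<lambda>k. (f (x + h k) - f x) /\<^sub>R t k - f' (h k /\<^sub>R t k)) \<longlonglongrightarrow> 0"
    by (subst tendsto_norm_zero_iff[symmetric]) simp
  from tendsto_add[OF this tendsto[OF h]] show ?thesis by simp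
qed

text \<open>Peano form of Taylor's theorem, with \<open>g'\<close> differentiable at
  \<open>x\<close>. The mean value inequality is applied along the segment from \<open>x\<close> to
  \<open>x + h\<close>, where the derivative of the remainder is the first-order error of
  \<open>g'\<close> applied to \<open>h\<close>.\<close>

lemma second_order_remainder:
  fixes g :: "'a::real_normed_vector \<Rightarrow> 'b::real_inner"
  assumes g: "\<And>y. (g has_derivative blinfun_apply (g' y)) (at y)"
    and g': "(g' has_derivative blinfun_apply (g'' x)) (at x)"
  shows "(\<lambda>h. norm (g (x + h) - g x - g' x h - (1/2) *\<^sub>R g'' x h h) / (norm h)\<^sup>2) \<midarrow>0\<rightarrow> 0"
proof (rule LIM_I)
  fix e :: real assume "e > 0"
  have "(\<lambda>d. norm (g' (x + d) - g' x - g'' x d) / norm d) \<midarrow>0\<rightarrow> 0"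
    using g' by (simp add: has_derivative_at)
  from LIM_D[OF this, of "e / 2"] \<open>e > 0\<close> obtain d where d: "d > 0"
    "\<And>h. h \<noteq> 0 \<Longrightarrow> norm h < d \<Longrightarrow> norm (g' (x + h) - g' x - g'' x h) / norm h < e / 2" by auto
  have bd: "norm (g' (x + h) - g' x - g'' x h) \<le> e / 2 * norm h" if "norm h < d" for h
    using d(2)[OF _ that] by (cases "h = 0") (auto simp: divide_less_eq less_imp_le)
  have bd2: "norm (g (x + h) - g x - g' x h - (1/2) *\<^sub>R g'' x h h) \<le> e / 2 * (norm h)\<^sup>2" if h: "norm h < d" for h
  proof -
    \<comment> \<open>The increment of \<open>r\<close> over the unit interval is exactly the
      second-order remainder at \<open>h\<close>.\<close>
    define r where "r = (\<lambda>\<tau>::real. g (x + \<tau> *\<^sub>R h) - \<tau> *\<^sub>R g' x h - (\<tau>\<^sup>2 / 2) *\<^sub>R g'' x h h)"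
    define r' where "r' = (\<lambda>\<tau> s::real. s *\<^sub>R (g' (x + \<tau> *\<^sub>R h) - g' x - g'' x (\<tau> *\<^sub>R h)) h)"
    have der: "(r has_derivative r' \<tau>) (at \<tau>)" for \<tau>
      unfolding r_def r'_def
      by (rule derivative_eq_intros has_derivative_compose[OF _ g, of _ _ \<tau> UNIV] refl | simp)+
         (auto simp: blinfun.diff_left blinfun.scaleR_left blinfun.scaleR_right scaleR_diff_right
            blinfun.diff_right fun_eq_iff)
    have "\<exists>\<tau>\<in>{0<..<1}. norm (r 1 - r 0) \<le> norm (r' \<tau> (1 - 0))"
      by (rule mvt_general) (auto intro: der has_derivative_continuous_on has_derivative_at_withinI)
    then obtain \<tau> where \<tau>: "0 < \<tau>" "\<tau> < 1" "norm (r 1 - r 0) \<le> norm (r' \<tau> 1)" by auto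
    have le: "\<tau> * norm h \<le> norm h" using \<tau> by (simp add: mult_left_le_one_le)
    have "norm (r' \<tau> 1) \<le> norm (g' (x + \<tau> *\<^sub>R h) - g' x - g'' x (\<tau> *\<^sub>R h)) * norm h"
      by (simp add: r'_def norm_blinfun)
    also have "\<dots> \<le> e / 2 * norm (\<tau> *\<^sub>R h) * norm h"
      using le h \<tau> by (intro mult_right_mono bd) auto
    also have "\<dots> \<le> e / 2 * norm h * norm h"
      using le \<tau> \<open>e > 0\<close> by (intro mult_right_mono mult_left_mono) auto
    finally show ?thesis using \<tau>(3) by (simp add: r_def algebra_simps power2_eq_square)
  qed
  show "\<exists>s>0. \<forall>h. h \<noteq> 0 \<and> norm (h - 0) < s \<longrightarrow>
      norm (norm (g (x + h) - g x - g' x h - (1/2) *\<^sub>R g'' x h h) / (norm h)\<^sup>2 - 0) < e"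
  proof (intro exI[of _ d] conjI allI impI)
    fix h :: 'a assume h: "h \<noteq> 0 \<and> norm (h - 0) < d"
    have "e / 2 * (norm h)\<^sup>2 < e * (norm h)\<^sup>2" using h \<open>e > 0\<close> by simp
    with bd2[of h] h have "norm (g (x + h) - g x - g' x h - (1/2) *\<^sub>R g'' x h h) < e * (norm h)\<^sup>2" by simp
    then show "norm (norm (g (x + h) - g x - g' x h - (1/2) *\<^sub>R g'' x h h) / (norm h)\<^sup>2 - 0) < e"
      using h by (simp add: divide_less_eq)
  qed (rule d(1))
qed

text \<open>Writing \<open>h k = t k *\<^sub>R p k\<close> with \<open>p\<close> tending to
  \<open>v\<close>, the Peano remainder is \<open>o(t^2)\<close> and the quadratic term converges
  after division by \<open>t^2\<close>; the deviation \<open>q\<close> from the parabolic arc enters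
  at this order only through the continuous linear map \<open>g' x\<close>.\<close>

lemma second_order_sequence:
  fixes g :: "'a::real_normed_vector \<Rightarrow> 'b::real_inner"
  assumes g: "\<And>y. (g has_derivative blinfun_apply (g' y)) (at y)"
    and g': "(g' has_derivative blinfun_apply (g'' x)) (at x)"
    and t: "\<And>k. t k > (0::real)" "t \<longlonglongrightarrow> 0"
    and h: "(\<lambda>k. (h k - t k *\<^sub>R v - ((t k)\<^sup>2 / 2) *\<^sub>R w) /\<^sub>R (t k)\<^sup>2) \<longlonglongrightarrow> 0"
  shows "(\<lambda>k. (g (x + h k) - (g x + t k *\<^sub>R g' x v + ((t k)\<^sup>2 / 2) *\<^sub>R (g' x w + g'' x v v))) /\<^sub>R (t k)\<^sup>2) \<longlonglongrightarrow> 0"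
proof -
  define q where "q = (\<lambda>k. (h k - t k *\<^sub>R v - ((t k)\<^sup>2 / 2) *\<^sub>R w) /\<^sub>R (t k)\<^sup>2)"
  have tne: "t k \<noteq> 0" for k using t(1)[of k] by simp
  have hq: "h k = t k *\<^sub>R v + ((t k)\<^sup>2 / 2) *\<^sub>R w + (t k)\<^sup>2 *\<^sub>R q k" for k
    using tne[of k] by (simp add: q_def)
  have q: "q \<longlonglongrightarrow> 0" using h by (simp add: q_def)
  define p where "p = (\<lambda>k. v + (t k / 2) *\<^sub>R w + t k *\<^sub>R q k)"
  have hp: "h k = t k *\<^sub>R p k" for k
    by (simp add: hq p_def scaleR_add_right power2_eq_square)
  have "p \<longlonglongrightarrow> v + (0 / 2) *\<^sub>R w + 0 *\<^sub>R 0" unfolding p_def by (intro tendsto_intros t q) simp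
  then have p: "p \<longlonglongrightarrow> v" by simp
  have "(\<lambda>k. t k *\<^sub>R p k) \<longlonglongrightarrow> 0 *\<^sub>R v" by (intro tendsto_intros t p)
  then have h0: "h \<longlonglongrightarrow> 0" by (simp add: hp[abs_def])
  define R where "R = (\<lambda>h. norm (g (x + h) - g x - g' x h - (1/2) *\<^sub>R g'' x h h) / (norm h)\<^sup>2)"
  have "R \<midarrow>0\<rightarrow> 0" unfolding R_def by (rule second_order_remainder[where g = g and g' = g' and g'' = g'', OF g g'])
  then have "isCont R 0" by (simp add: isCont_def R_def)
  then have "(\<lambda>k. R (h k)) \<longlonglongrightarrow> 0" using isCont_tendsto_compose[OF _ h0] by (fastforce simp: R_def)
  then have "(\<lambda>k. R (h k) * (norm (p k))\<^sup>2) \<longlonglongrightarrow> 0 * (norm v)\<^sup>2" by (intro tendsto_intros p)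
  moreover have "norm ((g (x + h k) - g x - g' x (h k) - (1/2) *\<^sub>R g'' x (h k) (h k)) /\<^sub>R (t k)\<^sup>2)
      = R (h k) * (norm (p k))\<^sup>2" for k
  proof (cases "p k = 0")
    case True
    then show ?thesis by (simp add: hp R_def blinfun.zero_left blinfun.zero_right)
  next
    case False
    have "(norm (h k))\<^sup>2 = (t k)\<^sup>2 * (norm (p k))\<^sup>2" by (simp add: hp power_mult_distrib)
    moreover have "(t k)\<^sup>2 > 0" "(norm (p k))\<^sup>2 > 0" using tne[of k] False by simp_all
    moreover have "norm (X /\<^sub>R a) = norm X / (a * b) * b" if "a > 0" "b > 0" for X :: 'b and a b :: real
      using that by (simp add: field_simps)
    ultimately show ?thesis unfolding R_def by presburger
  qed
  ultimately have 1: "(\<lambda>k. (g (x + h k) - g x - g' x (h k) - (1/2) *\<^sub>R g'' x (h k) (h k)) /\<^sub>R (t k)\<^sup>2) \<longlonglongrightarrow> 0"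
    by (subst tendsto_norm_zero_iff[symmetric]) simp
  have "(\<lambda>k. (1/2) *\<^sub>R (g'' x (p k) (p k) - g'' x v v)) \<longlonglongrightarrow> (1/2) *\<^sub>R (g'' x v v - g'' x v v)"
    by (intro tendsto_intros p)
  then have 2: "(\<lambda>k. (1/2) *\<^sub>R (g'' x (p k) (p k) - g'' x v v)) \<longlonglongrightarrow> 0" by simp
  have "(\<lambda>k. g' x (q k)) \<longlonglongrightarrow> g' x 0" by (intro tendsto_intros q)
  then have 3: "(\<lambda>k. g' x (q k)) \<longlonglongrightarrow> 0" by (simp add: blinfun.zero_right)
  have "(g (x + h k) - (g x + t k *\<^sub>R g' x v + ((t k)\<^sup>2 / 2) *\<^sub>R (g' x w + g'' x v v))) /\<^sub>R (t k)\<^sup>2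
      = (g (x + h k) - g x - g' x (h k) - (1/2) *\<^sub>R g'' x (h k) (h k)) /\<^sub>R (t k)\<^sup>2
        + (1/2) *\<^sub>R (g'' x (p k) (p k) - g'' x v v) + g' x (q k)" for k
  proof -
    have "g' x (h k) = t k *\<^sub>R g' x v + ((t k)\<^sup>2 / 2) *\<^sub>R g' x w + (t k)\<^sup>2 *\<^sub>R g' x (q k)"
      by (simp add: hq blinfun.add_right blinfun.scaleR_right)
    moreover have "g'' x (h k) (h k) = (t k)\<^sup>2 *\<^sub>R g'' x (p k) (p k)"
      by (simp add: hp blinfun.scaleR_left blinfun.scaleR_right power2_eq_square)
    ultimately have "g (x + h k) - (g x + t k *\<^sub>R g' x v + ((t k)\<^sup>2 / 2) *\<^sub>R (g' x w + g'' x v v))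
      = (g (x + h k) - g x - g' x (h k) - (1/2) *\<^sub>R g'' x (h k) (h k))
        + (t k)\<^sup>2 *\<^sub>R ((1/2) *\<^sub>R (g'' x (p k) (p k) - g'' x v v) + g' x (q k))"
      by (simp add: algebra_simps)
    moreover have "X /\<^sub>R a = Z /\<^sub>R a + Y1 + Y2" if "X = Z + a *\<^sub>R (Y1 + Y2)" "a \<noteq> 0"
      for X Z Y1 Y2 :: 'b and a using that by (simp add: scaleR_add_right)
    moreover have "(t k)\<^sup>2 \<noteq> 0" using tne[of k] by simp
    ultimately show ?thesis by blast
  qed
  then show ?thesis using tendsto_add[OF tendsto_add[OF 1 2] 3] by simp
qed

section \<open>Optimality, normals to the orthant and corrections by subregularity\<close>

lemma fermat_reg_normal:
  fixes f :: "'a::euclidean_space \<Rightarrow> real"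
  assumes f: "(f has_derivative f') (at y)" and y: "y \<in> S" and min: "\<And>x. x \<in> S \<Longrightarrow> f y \<le> f x"
  shows "- grad f' \<in> reg_normal S y"
proof -
  have "- grad f' \<bullet> w \<le> 0" if w: "w \<in> tangent_cone S y" for w
  proof -
    obtain t wk where t: "\<And>k. t k > (0::real)" "t \<longlonglongrightarrow> 0" and wk: "wk \<longlonglongrightarrow> w"
      and S: "\<And>k. y + t k *\<^sub>R wk k \<in> S" using tangent_coneE[OF w] by metis
    have "t k \<noteq> 0" for k using t(1)[of k] by simp
    then have "(\<lambda>k. (t k *\<^sub>R wk k) /\<^sub>R t k) \<longlonglongrightarrow> w" using wk by simp
    from has_derivative_sequence[OF f t this]
    have "(\<lambda>k. (f (y + t k *\<^sub>R wk k) - f y) /\<^sub>R t k) \<longlonglongrightarrow> f' w" .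
    moreover have "0 \<le> (f (y + t k *\<^sub>R wk k) - f y) /\<^sub>R t k" for k
      using min[OF S[of k]] t(1)[of k] by simp
    ultimately have "0 \<le> f' w" by (simp add: LIMSEQ_le_const)
    then show ?thesis using inner_grad[OF has_derivative_linear[OF f]] by (simp add: inner_minus_left)
  qed
  then show ?thesis using y by (simp add: reg_normal_def polar_cone_def)
qed

text \<open>The negative unit vectors are always tangent to the orthant, the positive ones at
  strictly negative coordinates; testing with both yields sign and complementarity.\<close>

lemma reg_normal_nonpos_orthant:
  "l \<in> reg_normal nonpos_orthant x \<longleftrightarrow>
     x \<in> nonpos_orthant \<and> (\<forall>i. 0 \<le> l $ i \<and> (x $ i \<noteq> 0 \<longrightarrow> l $ i = 0))"
proof (intro iffI conjI allI)
  assume l: "l \<in> reg_normal nonpos_orthant x"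
  then show x: "x \<in> nonpos_orthant" by (auto simp: reg_normal_def split: if_splits)
  have pol: "l \<bullet> w \<le> 0" if "w \<in> tangent_cone nonpos_orthant x" for w
    using l that by (auto simp: reg_normal_def polar_cone_def split: if_splits)
  fix i
  have "axis i (- 1) \<in> tangent_cone nonpos_orthant x"
    using x by (intro tangent_coneI_ray[of 1]) (auto simp: nonpos_orthant_def axis_def intro: order_trans[of _ 0])
  from pol[OF this] show nn: "0 \<le> l $ i" by (simp add: inner_axis)
  show "x $ i \<noteq> 0 \<longrightarrow> l $ i = 0"
  proof
    assume "x $ i \<noteq> 0"
    then have "x $ i < 0" using x by (auto simp: nonpos_orthant_def order_less_le)
    then have "axis i 1 \<in> tangent_cone nonpos_orthant x"
      using x by (intro tangent_coneI_ray[of "- x $ i"]) (auto simp: nonpos_orthant_def axis_def)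
    from pol[OF this] show "l $ i = 0" using nn by (simp add: inner_axis)
  qed
next
  assume l: "x \<in> nonpos_orthant \<and> (\<forall>i. 0 \<le> l $ i \<and> (x $ i \<noteq> 0 \<longrightarrow> l $ i = 0))"
  have "l \<bullet> w \<le> 0" if w: "w \<in> tangent_cone nonpos_orthant x" for w
  proof -
    obtain t wk where t: "\<And>k. t k > (0::real)" and wk: "wk \<longlonglongrightarrow> w"
      and S: "\<And>k. x + t k *\<^sub>R wk k \<in> nonpos_orthant" using tangent_coneE[OF w] by metis
    have "l $ i * w $ i \<le> 0" for i
    proof (cases "x $ i = 0")
      case True
      then have "wk k $ i \<le> 0" for k
        using S[of k] t[of k] by (auto simp: nonpos_orthant_def mult_le_0_iff dest!: spec[of _ i])
      then have "w $ i \<le> 0" using tendsto_vec_nth[OF wk, of i] by (simp add: LIMSEQ_le_const2)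
      then show ?thesis using l by (simp add: mult_nonneg_nonpos)
    qed (use l in simp)
    then show ?thesis by (auto simp: inner_vec_def intro: sum_nonpos)
  qed
  then show "l \<in> reg_normal nonpos_orthant x" using l by (simp add: reg_normal_def polar_cone_def)
qed

lemma eventually_nonpos_orthant:
  fixes x :: "real^'q::finite"
  assumes "x \<in> nonpos_orthant" "s \<longlonglongrightarrow> x" "\<And>i k. x $ i = 0 \<Longrightarrow> s k $ i \<le> 0"
  shows "eventually (\<lambda>k. s k \<in> nonpos_orthant) sequentially"
proof -
  have "eventually (\<lambda>k. \<forall>i\<in>UNIV. s k $ i \<le> 0) sequentially"
  proof (intro eventually_ball_finite ballI)
    fix i
    show "eventually (\<lambda>k. s k $ i \<le> 0) sequentially"
    proof (cases "x $ i = 0")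
      case False
      then have "x $ i < 0" using assms(1) by (auto simp: nonpos_orthant_def order_less_le)
      then have "eventually (\<lambda>k. s k $ i < 0) sequentially"
        using tendsto_vec_nth[OF assms(2), of i] by (simp add: order_tendstoD)
      then show ?thesis by eventually_elim simp
    qed (simp add: assms(3))
  qed simp
  then show ?thesis by (simp add: nonpos_orthant_def)
qed

lemma closed_nonpos_orthant: "closed (nonpos_orthant :: (real^'q::finite) set)"
proof -
  have "(nonpos_orthant :: (real^'q) set) = (\<Inter>i. {z. z $ i \<le> 0})" by (auto simp: nonpos_orthant_def)
  moreover have "closed (\<Inter>i. {z::real^'q. z $ i \<le> 0})"
    by (intro closed_INT ballI closed_Collect_le continuous_intros)
  ultimately show ?thesis by (simp only:)
qed

text \<open>Turns approximate feasibility into feasibility: the closest point of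
  \<open>\<Gamma>\<close> to \<open>c k\<close> is off by at most \<open>\<kappa>\<close> times the
  error of \<open>g (c k)\<close> against any reference value \<open>s k\<close> in the orthant, as
  soon as \<open>c k\<close> is near \<open>yb\<close>.\<close>

lemma subregular_projection:
  fixes g :: "'a::euclidean_space \<Rightarrow> real^'q::finite"
  assumes sub: "metric_subregular (\<lambda>y. {g y - s | s. s \<in> nonpos_orthant}) yb 0"
    and cont: "continuous_on UNIV g"
  shows "\<exists>\<kappa>>0. \<forall>c s. c \<longlonglongrightarrow> yb \<longrightarrow> eventually (\<lambda>k. s k \<in> nonpos_orthant) sequentially \<longrightarrow>
    (\<exists>y. (\<forall>k. g (y k) \<in> nonpos_orthant) \<and>
      eventually (\<lambda>k. norm (y k - c k) \<le> \<kappa> * norm (g (c k) - s k)) sequentially)"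
proof -
  define \<Gamma> where "\<Gamma> = {y. g y \<in> nonpos_orthant}"
  have \<Gamma>: "{y. 0 \<in> {g y - s | s. s \<in> nonpos_orthant}} = \<Gamma>" by (auto simp: \<Gamma>_def)
  have "closed \<Gamma>" using closed_vimage[OF closed_nonpos_orthant cont] by (simp add: \<Gamma>_def vimage_def)
  obtain W \<kappa> where W: "open W" "yb \<in> W" and \<kappa>: "\<kappa> > 0" and yb: "yb \<in> \<Gamma>"
    and sub': "\<And>z. z \<in> W \<Longrightarrow> {g z - s | s. s \<in> nonpos_orthant} \<noteq> {} \<Longrightarrow>
        infdist z \<Gamma> \<le> \<kappa> * infdist 0 {g z - s | s. s \<in> nonpos_orthant}"
    using sub unfolding metric_subregular_def \<Gamma> gph_def by (auto simp: \<Gamma>_def)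
  have ne: "\<Gamma> \<noteq> {}" using yb by auto
  have "\<exists>y. (\<forall>k. g (y k) \<in> nonpos_orthant) \<and>
      eventually (\<lambda>k. norm (y k - c k) \<le> \<kappa> * norm (g (c k) - s k)) sequentially"
    if c: "c \<longlonglongrightarrow> yb" and s: "eventually (\<lambda>k. s k \<in> nonpos_orthant) sequentially" for c s
  proof (intro exI conjI allI)
    show "g (closest_point \<Gamma> (c k)) \<in> nonpos_orthant" for k
      using closest_point_in_set[OF \<open>closed \<Gamma>\<close> ne] by (auto simp: \<Gamma>_def)
    have "eventually (\<lambda>k. c k \<in> W) sequentially" using topological_tendstoD[OF c W] .
    then show "eventually (\<lambda>k. norm (closest_point \<Gamma> (c k) - c k) \<le> \<kappa> * norm (g (c k) - s k)) sequentially"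
      using s
    proof eventually_elim
      case (elim k)
      have "norm (closest_point \<Gamma> (c k) - c k) = setdist {c k} \<Gamma>"
        using setdist_closest_point[OF \<open>closed \<Gamma>\<close> ne] by (simp add: dist_norm norm_minus_commute)
      also have "\<dots> = infdist (c k) \<Gamma>" by (simp add: infdist_eq_setdist)
      also have "\<dots> \<le> \<kappa> * infdist 0 {g (c k) - s | s. s \<in> nonpos_orthant}" using elim by (intro sub') auto
      also have "\<dots> \<le> \<kappa> * norm (g (c k) - s k)"
        using \<kappa> elim infdist_le[of "g (c k) - s k" "{g (c k) - s | s. s \<in> nonpos_orthant}" 0]
        by (intro mult_left_mono) auto
      finally show ?case .
    qed
  qed
  then show ?thesis using \<kappa> by blast
qed

lemma grad_add: "grad (\<lambda>u. L u + M u) = grad L + grad M"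
  by (simp add: grad_def scaleR_add_left sum.distrib)

lemma grad_diff: "grad (\<lambda>u. L u - M u) = grad L - grad M"
  by (simp add: grad_def scaleR_diff_left sum_subtractf)

lemma grad_scaleR: "grad (\<lambda>u. c * L u) = c *\<^sub>R grad L"
  by (simp add: grad_def scaleR_sum_right)

lemma tendsto_grad:
  assumes "\<And>u. (\<lambda>k. L k u) \<longlonglongrightarrow> M u"
  shows "(\<lambda>k. grad (L k)) \<longlonglongrightarrow> grad M"
  unfolding grad_def by (intro tendsto_intros assms)

lemma tendsto_null_scaled_bound:
  fixes r :: "nat \<Rightarrow> real"
  assumes le: "eventually (\<lambda>k. norm (a k) \<le> \<kappa> * norm (b k)) sequentially"
    and b: "(\<lambda>k. b k /\<^sub>R r k) \<longlonglongrightarrow> 0"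
  shows "(\<lambda>k. a k /\<^sub>R r k) \<longlonglongrightarrow> 0"
proof (rule Lim_null_comparison)
  show "(\<lambda>k. \<kappa> * norm (b k /\<^sub>R r k)) \<longlonglongrightarrow> 0"
    using tendsto_mult[OF tendsto_const[of \<kappa>] tendsto_norm[OF b]] by simp
  show "eventually (\<lambda>k. norm (a k /\<^sub>R r k) \<le> \<kappa> * norm (b k /\<^sub>R r k)) sequentially"
    using le
  proof eventually_elim
    case (elim k)
    from mult_left_mono[OF this, of "\<bar>inverse (r k)\<bar>"] show ?case
      by (simp add: mult.left_commute)
  qed
qed

text \<open>As \<open>l\<close> is nonnegative, \<open>- (l \<bullet> g y)\<close> is nonnegative on
  \<open>\<Gamma>\<close>. Adding the squared distance to \<open>y0\<close> yields a minimizer whose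
  value does not exceed that at \<open>y0\<close>, which bounds the distance; Fermat's rule then
  gives the normal.\<close>

lemma approximate_maximizer_normal:
  fixes g :: "'a::euclidean_space \<Rightarrow> real^'q::finite"
  defines "\<Gamma> \<equiv> {y. g y \<in> nonpos_orthant}"
  assumes g: "\<And>y. (g has_derivative blinfun_apply (g' y)) (at y)"
    and l: "\<And>i. 0 \<le> l $ i" and y0: "y0 \<in> \<Gamma>"
  shows "\<exists>y\<in>\<Gamma>. (norm (y - y0))\<^sup>2 \<le> - (l \<bullet> g y0) \<and>
           grad (\<lambda>u. l \<bullet> g' y u) - 2 *\<^sub>R (y - y0) \<in> reg_normal \<Gamma> y"
proof -
  define \<delta> where "\<delta> = - (l \<bullet> g y0)"
  define f where "f = (\<lambda>y. - (l \<bullet> g y) + (y - y0) \<bullet> (y - y0))"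
  have contg: "continuous_on UNIV g"
    by (simp add: continuous_at_imp_continuous_on has_derivative_continuous[OF g])
  have contf: "continuous_on S f" for S
    unfolding f_def by (intro continuous_intros continuous_on_subset[OF contg]) simp
  have "closed \<Gamma>" using closed_vimage[OF closed_nonpos_orthant contg] by (simp add: \<Gamma>_def vimage_def)
  have nonneg: "0 \<le> - (l \<bullet> g y)" if "y \<in> \<Gamma>" for y
    using that l by (auto simp: \<Gamma>_def nonpos_orthant_def inner_vec_def intro!: sum_nonpos mult_nonneg_nonpos)
  have "\<delta> \<ge> 0" using nonneg[OF y0] by (simp add: \<delta>_def)
  \<comment> \<open>Outside this ball the penalty alone exceeds \<open>\<delta>\<close>, the value
    of \<open>f\<close> at \<open>y0\<close>, so a minimizer over the compact set \<open>S\<close>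
    is one over \<open>\<Gamma>\<close>.\<close>
  define S where "S = \<Gamma> \<inter> cball y0 (\<delta> + 1)"
  have "compact S" unfolding S_def using \<open>closed \<Gamma>\<close> by (rule closed_Int_compact) simp
  moreover have "y0 \<in> S" using y0 \<open>\<delta> \<ge> 0\<close> by (simp add: S_def)
  ultimately obtain y where y: "y \<in> S" "\<And>x. x \<in> S \<Longrightarrow> f y \<le> f x"
    using continuous_attains_inf[OF _ _ contf, of S] by auto
  have yG: "y \<in> \<Gamma>" using y by (simp add: S_def)
  have fy: "f y \<le> \<delta>" using y(2)[OF \<open>y0 \<in> S\<close>] by (simp add: f_def \<delta>_def)
  have min: "f y \<le> f x" if "x \<in> \<Gamma>" for x
  proof (cases "x \<in> S")
    case False
    then have n: "norm (x - y0) > \<delta> + 1" using that by (simp add: S_def dist_norm norm_minus_commute)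
    then have "norm (x - y0) * 1 \<le> norm (x - y0) * norm (x - y0)"
      using \<open>\<delta> \<ge> 0\<close> by (intro mult_left_mono) auto
    also have "\<dots> = (x - y0) \<bullet> (x - y0)" by (simp add: power2_norm_eq_inner[symmetric] power2_eq_square)
    finally show ?thesis using fy n nonneg[OF that] by (simp add: f_def)
  qed (rule y)
  have df: "(f has_derivative (\<lambda>u. - (l \<bullet> g' y u) + 2 * ((y - y0) \<bullet> u))) (at y)"
    unfolding f_def by (rule derivative_eq_intros g refl | simp)+ (simp add: fun_eq_iff inner_commute)
  have "grad (\<lambda>u. - (l \<bullet> g' y u) + 2 * ((y - y0) \<bullet> u)) \<bullet> u = (2 *\<^sub>R (y - y0) - grad (\<lambda>u. l \<bullet> g' y u)) \<bullet> u" for u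
    unfolding inner_grad[OF has_derivative_linear[OF df]] unfolding inner_diff_left inner_grad[OF linear_inner_blinfun]
    by (simp add: inner_diff_left)
  then have "grad (\<lambda>u. - (l \<bullet> g' y u) + 2 * ((y - y0) \<bullet> u)) = 2 *\<^sub>R (y - y0) - grad (\<lambda>u. l \<bullet> g' y u)"
    by (rule inner_ext)
  with fermat_reg_normal[OF df yG min]
  have "grad (\<lambda>u. l \<bullet> g' y u) - 2 *\<^sub>R (y - y0) \<in> reg_normal \<Gamma> y" by simp
  moreover have "(norm (y - y0))\<^sup>2 \<le> - (l \<bullet> g y0)"
    using fy nonneg[OF yG] by (simp add: f_def \<delta>_def power2_norm_eq_inner)
  ultimately show ?thesis using yG by blast
qed

text \<open>Abadie's qualification condition obtained from subregularity: a step \<open>t k\<close>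
  along a linearized feasible direction misses feasibility by \<open>o(t)\<close>, and projecting
  back to \<open>\<Gamma>\<close> costs no more than that.\<close>

lemma tangent_cone_inequalities:
  fixes g :: "'a::euclidean_space \<Rightarrow> real^'q::finite"
  defines "\<Gamma> \<equiv> {y. g y \<in> nonpos_orthant}"
  assumes g: "\<And>y. (g has_derivative blinfun_apply (g' y)) (at y)"
    and sub: "metric_subregular (\<lambda>y. {g y - s | s. s \<in> nonpos_orthant}) yb 0"
  shows "v \<in> tangent_cone \<Gamma> yb \<longleftrightarrow> (\<forall>i. g yb $ i = 0 \<longrightarrow> g' yb v $ i \<le> 0)"
proof
  have contg: "continuous_on UNIV g"
    by (simp add: continuous_at_imp_continuous_on has_derivative_continuous[OF g])
  have yb: "g yb \<in> nonpos_orthant" using sub by (auto simp: metric_subregular_def gph_def)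
  {
    assume v: "\<forall>i. g yb $ i = 0 \<longrightarrow> g' yb v $ i \<le> 0"
    define t where "t = (\<lambda>k. 1 / real (Suc k))"
    have t: "\<And>k. t k > 0" "t \<longlonglongrightarrow> 0"
      using LIMSEQ_inverse_real_of_nat by (auto simp: t_def inverse_eq_divide)
    have tne: "t k \<noteq> 0" for k using t(1)[of k] by simp
    define c where "c = (\<lambda>k. yb + t k *\<^sub>R v)"
    \<comment> \<open>The first-order prediction of \<open>g (c k)\<close>, which eventually lies in
      the orthant and so serves as reference value.\<close>
    define s where "s = (\<lambda>k. g yb + t k *\<^sub>R g' yb v)"
    have "c \<longlonglongrightarrow> yb + 0 *\<^sub>R v" unfolding c_def by (intro tendsto_intros t)
    then have c: "c \<longlonglongrightarrow> yb" by simp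
    have "s \<longlonglongrightarrow> g yb + 0 *\<^sub>R g' yb v" unfolding s_def by (intro tendsto_intros t)
    then have slim: "s \<longlonglongrightarrow> g yb" by simp
    have s: "eventually (\<lambda>k. s k \<in> nonpos_orthant) sequentially"
    proof (rule eventually_nonpos_orthant[OF yb slim])
      fix i k assume i: "g yb $ i = 0"
      have "t k * g' yb v $ i \<le> 0" using v i t(1)[of k] by (simp add: mult_nonneg_nonpos)
      then show "s k $ i \<le> 0" using i by (simp add: s_def)
    qed
    obtain \<kappa> y where y: "\<And>k. g (y k) \<in> nonpos_orthant"
      and le: "eventually (\<lambda>k. norm (y k - c k) \<le> \<kappa> * norm (g (c k) - s k)) sequentially"
      using subregular_projection[OF sub contg] c s by blast
    have "(\<lambda>k. (t k *\<^sub>R v) /\<^sub>R t k) \<longlonglongrightarrow> v" using tne by simp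
    from has_derivative_sequence[OF g t this, of yb]
    have "(\<lambda>k. (g (c k) - g yb) /\<^sub>R t k - g' yb v) \<longlonglongrightarrow> g' yb v - g' yb v"
      unfolding c_def by (intro tendsto_intros)
    then have "(\<lambda>k. (g (c k) - s k) /\<^sub>R t k) \<longlonglongrightarrow> 0"
      using tne by (simp add: s_def scaleR_diff_right scaleR_add_right algebra_simps)
    from tendsto_null_scaled_bound[OF le this] have "(\<lambda>k. (y k - c k) /\<^sub>R t k) \<longlonglongrightarrow> 0" .
    from tendsto_add[OF this tendsto_const[of v]]
    have "(\<lambda>k. (y k - yb) /\<^sub>R t k) \<longlonglongrightarrow> v"
      using tne by (simp add: c_def algebra_simps)
    then show "v \<in> tangent_cone \<Gamma> yb"
      by (rule tangent_coneI_sequentially[OF t]) (use tne y in \<open>simp add: \<Gamma>_def\<close>)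
  next
    assume "v \<in> tangent_cone \<Gamma> yb"
    then obtain t wk where t: "\<And>k. t k > (0::real)" "t \<longlonglongrightarrow> 0" and wk: "wk \<longlonglongrightarrow> v"
      and S: "\<And>k. yb + t k *\<^sub>R wk k \<in> \<Gamma>" using tangent_coneE by metis
    have "t k \<noteq> 0" for k using t(1)[of k] by simp
    then have "(\<lambda>k. (t k *\<^sub>R wk k) /\<^sub>R t k) \<longlonglongrightarrow> v" using wk by simp
    from has_derivative_sequence[OF g t this, of yb]
    have lim: "(\<lambda>k. (g (yb + t k *\<^sub>R wk k) - g yb) /\<^sub>R t k) \<longlonglongrightarrow> g' yb v" .
    show "\<forall>i. g yb $ i = 0 \<longrightarrow> g' yb v $ i \<le> 0"
    proof (intro allI impI)
      fix i assume i: "g yb $ i = 0"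
      have le: "((g (yb + t k *\<^sub>R wk k) - g yb) /\<^sub>R t k) $ i \<le> 0" for k
        using S[of k] t(1)[of k] i by (simp add: \<Gamma>_def nonpos_orthant_def mult_nonneg_nonpos)
      show "g' yb v $ i \<le> 0"
        by (rule LIMSEQ_le_const2[OF tendsto_vec_nth[OF lim]]) (use le in blast)
    qed
  }
qed

text \<open>The multiplier \<open>l + t k *\<^sub>R \<mu>\<close> produces the normals. By
  complementarity its product with \<open>g\<close> is \<open>o(t^2)\<close> at feasible points near
  the arc with velocity \<open>v\<close> and acceleration \<open>w\<close>. The penalized maximizer
  is then within \<open>o(t)\<close> of these points, which disturbs neither its own velocity nor
  that of the normals.\<close>

lemma graph_normal_sequence:
  fixes g :: "'a::euclidean_space \<Rightarrow> real^'q::finite"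
  defines "\<Gamma> \<equiv> {y. g y \<in> nonpos_orthant}"
  assumes g: "\<And>y. (g has_derivative blinfun_apply (g' y)) (at y)"
    and g': "(g' has_derivative blinfun_apply (g'' yb)) (at yb)"
    and sub: "metric_subregular (\<lambda>y. {g y - s | s. s \<in> nonpos_orthant}) yb 0"
    and l: "\<And>i. 0 \<le> l $ i" "\<And>i. g yb $ i \<noteq> 0 \<Longrightarrow> l $ i = 0"
    and v: "\<And>i. g yb $ i = 0 \<Longrightarrow> g' yb v $ i \<le> 0 \<and> (0 < l $ i \<longrightarrow> g' yb v $ i = 0)"
    and w: "\<And>i. g yb $ i = 0 \<Longrightarrow> (g' yb w + g'' yb v v) $ i \<le> 0 \<and> (0 < l $ i \<longrightarrow> (g' yb w + g'' yb v v) $ i = 0)"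
    and \<mu>: "\<And>i. g yb $ i \<noteq> 0 \<Longrightarrow> \<mu> $ i = 0" "\<And>i. l $ i = 0 \<Longrightarrow> 0 \<le> \<mu> $ i" "\<And>i. \<mu> $ i * g' yb v $ i = 0"
    and t: "\<And>k. t k > (0::real)" "t \<longlonglongrightarrow> 0"
  shows "\<exists>y ys. eventually (\<lambda>k. ys k \<in> reg_normal \<Gamma> (y k)) sequentially
    \<and> (\<lambda>k. (y k - yb) /\<^sub>R t k) \<longlonglongrightarrow> v
    \<and> (\<lambda>k. (ys k - grad (\<lambda>u. l \<bullet> g' yb u)) /\<^sub>R t k) \<longlonglongrightarrow>
         grad (\<lambda>u. l \<bullet> g'' yb v u) + grad (\<lambda>u. \<mu> \<bullet> g' yb u)"
proof -
  have contg: "continuous_on UNIV g"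
    by (simp add: continuous_at_imp_continuous_on has_derivative_continuous[OF g])
  have yb: "g yb \<in> nonpos_orthant" using sub by (auto simp: metric_subregular_def gph_def)
  have tne: "t k \<noteq> 0" for k using t(1)[of k] by simp
  define q where "q = g' yb w + g'' yb v v"
  define c where "c = (\<lambda>k. yb + t k *\<^sub>R v + ((t k)\<^sup>2 / 2) *\<^sub>R w)"
  \<comment> \<open>The second-order prediction of \<open>g (c k)\<close>; the sign conditions on
    \<open>v\<close> and \<open>w\<close> put it into the orthant eventually.\<close>
  define s where "s = (\<lambda>k. g yb + t k *\<^sub>R g' yb v + ((t k)\<^sup>2 / 2) *\<^sub>R q)"
  have "c \<longlonglongrightarrow> yb + 0 *\<^sub>R v + (0\<^sup>2 / 2) *\<^sub>R w" unfolding c_def by (intro tendsto_intros t) simp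
  then have c: "c \<longlonglongrightarrow> yb" by simp
  have "s \<longlonglongrightarrow> g yb + 0 *\<^sub>R g' yb v + (0\<^sup>2 / 2) *\<^sub>R q" unfolding s_def by (intro tendsto_intros t) simp
  then have slim: "s \<longlonglongrightarrow> g yb" by simp
  have s: "eventually (\<lambda>k. s k \<in> nonpos_orthant) sequentially"
  proof (rule eventually_nonpos_orthant[OF yb slim])
    fix i k assume i: "g yb $ i = 0"
    have "t k * g' yb v $ i \<le> 0" "(t k)\<^sup>2 / 2 * q $ i \<le> 0"
      using v[OF i] w[OF i] t(1)[of k] by (simp_all add: q_def mult_nonneg_nonpos del: vector_add_component)
    then show "s k $ i \<le> 0" using i by (simp add: s_def)
  qed
  obtain \<kappa> z where z: "\<And>k. g (z k) \<in> nonpos_orthant"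
    and le: "eventually (\<lambda>k. norm (z k - c k) \<le> \<kappa> * norm (g (c k) - s k)) sequentially"
    using subregular_projection[OF sub contg] c s by blast
  have "(\<lambda>k. (g (yb + (c k - yb)) - (g yb + t k *\<^sub>R g' yb v + ((t k)\<^sup>2 / 2) *\<^sub>R (g' yb w + g'' yb v v))) /\<^sub>R (t k)\<^sup>2) \<longlonglongrightarrow> 0"
    by (rule second_order_sequence[where g = g and g' = g' and g'' = g'', OF g g' t]) (simp add: c_def)
  then have gc: "(\<lambda>k. (g (c k) - s k) /\<^sub>R (t k)\<^sup>2) \<longlonglongrightarrow> 0" by (simp add: s_def q_def)
  from tendsto_null_scaled_bound[OF le this] have zc: "(\<lambda>k. (z k - c k) /\<^sub>R (t k)\<^sup>2) \<longlonglongrightarrow> 0" .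
  \<comment> \<open>The feasible points \<open>z k\<close> differ from the arc by
    \<open>o(t^2)\<close> and therefore share its second-order expansion.\<close>
  have "(\<lambda>k. (g (yb + (z k - yb)) - (g yb + t k *\<^sub>R g' yb v + ((t k)\<^sup>2 / 2) *\<^sub>R (g' yb w + g'' yb v v))) /\<^sub>R (t k)\<^sup>2) \<longlonglongrightarrow> 0"
    by (rule second_order_sequence[where g = g and g' = g' and g'' = g'', OF g g' t]) (use zc in \<open>simp add: c_def algebra_simps\<close>)
  then have gz: "(\<lambda>k. (g (z k) - s k) /\<^sub>R (t k)\<^sup>2) \<longlonglongrightarrow> 0" by (simp add: s_def q_def)
  define L where "L = (\<lambda>k. l + t k *\<^sub>R \<mu>)"
  have "L \<longlonglongrightarrow> l + 0 *\<^sub>R \<mu>" unfolding L_def by (intro tendsto_intros t)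
  then have Llim: "L \<longlonglongrightarrow> l" by simp
  \<comment> \<open>Negative entries of \<open>\<mu>\<close> occur only where \<open>l\<close> is
    positive, so they are absorbed for large \<open>k\<close>.\<close>
  have Lnn: "eventually (\<lambda>k. \<forall>i\<in>UNIV. 0 \<le> L k $ i) sequentially"
  proof (intro eventually_ball_finite ballI)
    fix i
    show "eventually (\<lambda>k. 0 \<le> L k $ i) sequentially"
    proof (cases "l $ i = 0")
      case True
      then show ?thesis using \<mu>(2)[of i] t(1) by (simp add: L_def less_imp_le)
    next
      case False
      then have "0 < l $ i" using l(1)[of i] by simp
      then have "eventually (\<lambda>k. 0 < L k $ i) sequentially"
        using tendsto_vec_nth[OF Llim, of i] by (simp add: order_tendstoD)
      then show ?thesis by eventually_elim simp
    qed
  qed simp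
  define \<delta> where "\<delta> = (\<lambda>k. - (L k \<bullet> g (z k)))"
  \<comment> \<open>Complementarity cancels the products of order \<open>1\<close>, \<open>t\<close>
    and \<open>t^2\<close>; a single cubic term remains.\<close>
  have Ls: "L k \<bullet> s k = (t k)\<^sup>2 * (t k * (\<mu> \<bullet> q) / 2)" for k
  proof -
    have "L k $ i * s k $ i = (t k)\<^sup>2 * (t k * (\<mu> $ i * q $ i) / 2)" for i
    proof (cases "g yb $ i = 0")
      case False
      then show ?thesis using l \<mu> by (simp add: L_def)
    next
      case True
      have "l $ i * g' yb v $ i = 0" "l $ i * q $ i = 0"
        using v[OF True] w[OF True] l(1)[of i] by (auto simp: q_def order_less_le simp del: vector_add_component)
      then show ?thesis using \<mu>(3)[of i] True
        by (auto simp: L_def s_def algebra_simps power2_eq_square)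
    qed
    then have "L k \<bullet> s k = (\<Sum>i\<in>UNIV. (t k)\<^sup>2 * (t k * (\<mu> $ i * q $ i) / 2))"
      unfolding inner_vec_def by (intro sum.cong) simp_all
    then show ?thesis by (simp add: inner_vec_def sum_distrib_left sum_divide_distrib)
  qed
  have "(\<lambda>k. - (L k \<bullet> ((g (z k) - s k) /\<^sub>R (t k)\<^sup>2)) - t k * (\<mu> \<bullet> q) / 2) \<longlonglongrightarrow> - (l \<bullet> 0) - 0 * (\<mu> \<bullet> q) / 2"
    by (intro tendsto_intros Llim gz t) simp
  moreover have "\<delta> k / (t k)\<^sup>2 = - (L k \<bullet> ((g (z k) - s k) /\<^sub>R (t k)\<^sup>2)) - t k * (\<mu> \<bullet> q) / 2" for k
    using tne[of k] by (simp add: \<delta>_def inner_diff_right Ls field_simps)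
  ultimately have \<delta>: "(\<lambda>k. \<delta> k / (t k)\<^sup>2) \<longlonglongrightarrow> 0" by simp
  \<comment> \<open>\<open>L k\<close> may have negative entries for small \<open>k\<close>, hence
    the choice under an implication.\<close>
  have "\<exists>y. (\<forall>i. 0 \<le> L k $ i) \<longrightarrow> ((norm (y - z k))\<^sup>2 \<le> \<delta> k \<and>
           grad (\<lambda>u. L k \<bullet> g' y u) - 2 *\<^sub>R (y - z k) \<in> reg_normal \<Gamma> y)" for k
    using approximate_maximizer_normal[OF g, of "L k" "z k"] z[of k] unfolding \<Gamma>_def \<delta>_def by blast
  then obtain y where y: "\<And>k. \<forall>i. 0 \<le> L k $ i \<Longrightarrow> (norm (y k - z k))\<^sup>2 \<le> \<delta> k"
    "\<And>k. \<forall>i. 0 \<le> L k $ i \<Longrightarrow> grad (\<lambda>u. L k \<bullet> g' (y k) u) - 2 *\<^sub>R (y k - z k) \<in> reg_normal \<Gamma> (y k)"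
    by metis
  define ys where "ys = (\<lambda>k. grad (\<lambda>u. L k \<bullet> g' (y k) u) - 2 *\<^sub>R (y k - z k))"
  have "(\<lambda>k. sqrt (\<delta> k / (t k)\<^sup>2)) \<longlonglongrightarrow> sqrt 0" by (intro tendsto_intros \<delta>)
  then have sq0: "(\<lambda>k. sqrt (\<delta> k / (t k)\<^sup>2)) \<longlonglongrightarrow> 0" by simp
  have yz: "(\<lambda>k. (y k - z k) /\<^sub>R t k) \<longlonglongrightarrow> 0"
  proof (rule Lim_null_comparison[OF _ sq0])
    show "eventually (\<lambda>k. norm ((y k - z k) /\<^sub>R t k) \<le> sqrt (\<delta> k / (t k)\<^sup>2)) sequentially"
      using Lnn
    proof eventually_elim
      case (elim k)
      have "(norm ((y k - z k) /\<^sub>R t k))\<^sup>2 = (norm (y k - z k))\<^sup>2 / (t k)\<^sup>2"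
        unfolding norm_scaleR power_mult_distrib by (simp add: power_inverse divide_inverse)
      also have "\<dots> \<le> \<delta> k / (t k)\<^sup>2" using y(1)[of k] elim by (intro divide_right_mono) auto
      finally show ?case by (rule real_le_rsqrt)
    qed
  qed
  \<comment> \<open>The summands are the projection error, the displacement along the arc and the
    penalization error, each divided by \<open>t k\<close>.\<close>
  have "(\<lambda>k. t k *\<^sub>R ((z k - c k) /\<^sub>R (t k)\<^sup>2) + (v + (t k / 2) *\<^sub>R w) + (y k - z k) /\<^sub>R t k)
      \<longlonglongrightarrow> 0 *\<^sub>R 0 + (v + (0 / 2) *\<^sub>R w) + 0"
    by (intro tendsto_intros t zc yz) simp
  moreover have "t k *\<^sub>R ((z k - c k) /\<^sub>R (t k)\<^sup>2) + (v + (t k / 2) *\<^sub>R w) + (y k - z k) /\<^sub>R t k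
      = (y k - yb) /\<^sub>R t k" for k
  proof -
    have "v + (t k / 2) *\<^sub>R w = (c k - yb) /\<^sub>R t k"
      using tne[of k] by (simp add: c_def scaleR_add_right power2_eq_square)
    moreover have "t k *\<^sub>R ((z k - c k) /\<^sub>R (t k)\<^sup>2) = (z k - c k) /\<^sub>R t k"
      using tne[of k] by (simp add: power2_eq_square)
    ultimately show ?thesis unfolding scaleR_diff_right by simp
  qed
  ultimately have ylim: "(\<lambda>k. (y k - yb) /\<^sub>R t k) \<longlonglongrightarrow> v" by simp
  have "(\<lambda>k. yb + t k *\<^sub>R ((y k - yb) /\<^sub>R t k)) \<longlonglongrightarrow> yb + 0 *\<^sub>R v" by (intro tendsto_intros t ylim)
  then have "y \<longlonglongrightarrow> yb" using tne by simp
  then have g'lim: "(\<lambda>k. g' (y k)) \<longlonglongrightarrow> g' yb"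
    using isCont_tendsto_compose[OF has_derivative_continuous[OF g']] by blast
  from has_derivative_sequence[OF g' t ylim]
  have g''lim: "(\<lambda>k. (g' (y k) - g' yb) /\<^sub>R t k) \<longlonglongrightarrow> g'' yb v" by simp
  \<comment> \<open>The three terms come from the variation of \<open>g'\<close>, the variation of
    the multiplier and the gradient of the penalty.\<close>
  have "(\<lambda>k. grad (\<lambda>u. l \<bullet> ((g' (y k) - g' yb) /\<^sub>R t k) u) + grad (\<lambda>u. \<mu> \<bullet> g' (y k) u) - 2 *\<^sub>R ((y k - z k) /\<^sub>R t k))
      \<longlonglongrightarrow> grad (\<lambda>u. l \<bullet> g'' yb v u) + grad (\<lambda>u. \<mu> \<bullet> g' yb u) - 2 *\<^sub>R 0"
    by (intro tendsto_intros tendsto_grad yz g'lim g''lim)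
  moreover have "grad (\<lambda>u. l \<bullet> ((g' (y k) - g' yb) /\<^sub>R t k) u) + grad (\<lambda>u. \<mu> \<bullet> g' (y k) u) - 2 *\<^sub>R ((y k - z k) /\<^sub>R t k)
      = (ys k - grad (\<lambda>u. l \<bullet> g' yb u)) /\<^sub>R t k" for k
  proof -
    have "(\<lambda>u. l \<bullet> ((g' (y k) - g' yb) /\<^sub>R t k) u) = (\<lambda>u. inverse (t k) * (l \<bullet> g' (y k) u - l \<bullet> g' yb u))"
      by (simp add: blinfun.scaleR_left blinfun.diff_left inner_diff_right)
    then have 1: "grad (\<lambda>u. l \<bullet> ((g' (y k) - g' yb) /\<^sub>R t k) u)
        = (grad (\<lambda>u. l \<bullet> g' (y k) u) - grad (\<lambda>u. l \<bullet> g' yb u)) /\<^sub>R t k"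
      by (simp only: grad_scaleR grad_diff)
    have "(\<lambda>u. L k \<bullet> g' (y k) u) = (\<lambda>u. l \<bullet> g' (y k) u + t k * (\<mu> \<bullet> g' (y k) u))"
      by (simp add: L_def inner_add_left)
    then have 2: "grad (\<lambda>u. L k \<bullet> g' (y k) u) = grad (\<lambda>u. l \<bullet> g' (y k) u) + t k *\<^sub>R grad (\<lambda>u. \<mu> \<bullet> g' (y k) u)"
      by (simp only: grad_scaleR grad_add)
    show ?thesis unfolding ys_def 1 2 using tne[of k]
      by (simp add: scaleR_add_right scaleR_diff_right mult.commute)
  qed
  ultimately have yslim: "(\<lambda>k. (ys k - grad (\<lambda>u. l \<bullet> g' yb u)) /\<^sub>R t k) \<longlonglongrightarrow>
         grad (\<lambda>u. l \<bullet> g'' yb v u) + grad (\<lambda>u. \<mu> \<bullet> g' yb u)" by simp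
  have "eventually (\<lambda>k. ys k \<in> reg_normal \<Gamma> (y k)) sequentially"
    using Lnn by eventually_elim (simp add: ys_def y(2))
  then show ?thesis using ylim yslim by blast
qed

section \<open>Stationarity conditions\<close>

lemma polar_cone_closed: "closed (polar_cone K)"
proof -
  have "polar_cone K = (\<Inter>w\<in>K. {z. z \<bullet> w \<le> 0})" by (auto simp: polar_cone_def)
  then show ?thesis by (auto intro!: closed_INT closed_Collect_le continuous_intros)
qed

lemma linear_inner_blinfun_fst:
  fixes B :: "('a::real_normed_vector \<times> 'c::real_normed_vector) \<Rightarrow>\<^sub>L 'b::real_inner"
  shows "linear (\<lambda>u. l \<bullet> B (u, 0))"
proof -
  have "linear (\<lambda>u::'a. (u, 0::'c))" by (intro linearI) simp_all
  from linear_compose[OF this linear_inner_blinfun[of l B]] show ?thesis by (simp add: o_def)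
qed

lemma linear_inner_blinfun_snd:
  fixes B :: "('a::real_normed_vector \<times> 'c::real_normed_vector) \<Rightarrow>\<^sub>L 'b::real_inner"
  shows "linear (\<lambda>u. l \<bullet> B (0, u))"
proof -
  have "linear (\<lambda>u::'c. (0::'a, u))" by (intro linearI) simp_all
  from linear_compose[OF this linear_inner_blinfun[of l B]] show ?thesis by (simp add: o_def)
qed

lemma conic_normal_graph:
  assumes "conic K" "(v, z) \<in> normal_graph K" "0 \<le> c"
  shows "(c *\<^sub>R v, c *\<^sub>R z) \<in> normal_graph K"
  using assms by (auto simp: normal_graph_def polar_cone_def conic_def mult_nonneg_nonpos)

lemma conic_lin_cone: "conic (lin_cone a I E)"
  by (auto simp: conic_def lin_cone_def mult_nonneg_nonpos)

theorem theorem5p3: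
  fixes F :: "(real^('n::finite)) \<times> (real^('m::finite)) \<Rightarrow> real"
    and F' :: "(real^'n) \<times> (real^'m) \<Rightarrow> ((real^'n) \<times> (real^'m)) \<Rightarrow>\<^sub>L real"
    and \<phi> :: "(real^'n) \<times> (real^'m) \<Rightarrow> (real^'m)"
    and \<phi>' :: "(real^'n) \<times> (real^'m) \<Rightarrow> ((real^'n) \<times> (real^'m)) \<Rightarrow>\<^sub>L (real^'m)"
    and G :: "(real^'n) \<times> (real^'m) \<Rightarrow> (real^('p::finite))"
    and G' :: "(real^'n) \<times> (real^'m) \<Rightarrow> ((real^'n) \<times> (real^'m)) \<Rightarrow>\<^sub>L (real^'p)"
    and g :: "(real^'m) \<Rightarrow> (real^('q::finite))"
    and g' :: "(real^'m) \<Rightarrow> (real^'m) \<Rightarrow>\<^sub>L (real^'q)"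
    and g'' :: "(real^'m) \<Rightarrow> (real^'m) \<Rightarrow>\<^sub>L (real^'m) \<Rightarrow>\<^sub>L (real^'q)"
    and xb :: "(real^'n)" and yb :: "(real^'m)"
    and \<Gamma> :: "((real^'m)) set"
    and P :: "(real^'n) \<times> (real^'m) \<Rightarrow> (((real^'m) \<times> (real^'m)) \<times> (real^'p))"
    and DP :: "(real^'n) \<times> (real^'m) \<Rightarrow> (((real^'m) \<times> (real^'m)) \<times> (real^'p))"
    and D :: "(((real^'m) \<times> (real^'m)) \<times> (real^'p)) set"
    and \<Omega>M :: "((real^'n) \<times> (real^'m)) set"
    and ybs :: "(real^'m)"
    and KG :: "((real^'m)) set"
    and \<Lambda>b :: "((real^'q)) set"
    and \<Lambda>v :: "(real^'m) \<Rightarrow> ((real^'q)) set"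
    and \<Lambda>t :: "((real^'q)) set"
  assumes F_deriv: "\<And>z. (F has_derivative blinfun_apply (F' z)) (at z)"
    and F_C1: "continuous_on UNIV F'"
    and \<phi>_deriv: "\<And>z. (\<phi> has_derivative blinfun_apply (\<phi>' z)) (at z)"
    and \<phi>_C1: "continuous_on UNIV \<phi>'"
    and G_deriv: "\<And>z. (G has_derivative blinfun_apply (G' z)) (at z)"
    and G_C1: "continuous_on UNIV G'"
    and g_deriv: "\<And>y. (g has_derivative blinfun_apply (g' y)) (at y)"
    and g'_deriv: "\<And>y. (g' has_derivative blinfun_apply (g'' y)) (at y)"
    and g_C2: "continuous_on UNIV g''"
    and \<Gamma>_def: "\<Gamma> = {y. g y \<in> nonpos_orthant}"
    and P_def: "\<And>x y. P (x, y) = ((y, - \<phi> (x, y)), G (x, y))"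
    and DP_def: "\<And>u v. DP (u, v) = ((v, - \<phi>' (xb, yb) (u, v)), G' (xb, yb) (u, v))"
    and D_def: "D = gph (reg_normal \<Gamma>) \<times> nonpos_orthant"
    and \<Omega>M_def: "\<Omega>M = {z. P z \<in> D}"
    and B_stationary: "0 \<in> (+) (grad (blinfun_apply (F' (xb, yb)))) ` reg_normal \<Omega>M (xb, yb)"
    and subreg_g: "metric_subregular (\<lambda>y. {g y - s | s. s \<in> nonpos_orthant}) yb 0"
    and GGCQ: "reg_normal \<Omega>M (xb, yb) = polar_cone {uv. DP uv \<in> tangent_cone D (P (xb, yb))}"
    and subreg_lin: "metric_subregular (\<lambda>uv. {DP uv - t | t. t \<in> tangent_cone D (P (xb, yb))}) (0, 0) 0"
    and ybs_def: "ybs = - \<phi> (xb, yb)"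
    and KG_def: "KG = crit_cone \<Gamma> yb ybs"
    and \<Lambda>b_def: "\<Lambda>b = {l \<in> reg_normal nonpos_orthant (g yb).
                     grad (\<lambda>u. inner l (g' yb u)) = ybs}"
    and \<Lambda>v_def: "\<And>v. \<Lambda>v v = {l \<in> \<Lambda>b. \<forall>l'\<in>\<Lambda>b.
                     inner l' (g'' yb v v) \<le> inner l (g'' yb v v)}"
    and \<Lambda>t_sub: "\<Lambda>t \<subseteq> \<Lambda>b"
    and \<Lambda>t_const: "\<And>v. v \<in> KG - {0} \<Longrightarrow> \<Lambda>v v = \<Lambda>t"
  shows "\<forall>lt \<in> \<Lambda>t. \<exists>v zs w \<mu>. v \<in> KG \<and> zs \<in> reg_normal KG v \<and> w \<in> crit_cone KG v zs
           \<and> \<mu> \<in> reg_normal nonpos_orthant (G (xb, yb))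
           \<and> 0 = grad (\<lambda>u. F' (xb, yb) (u, 0)) - grad (\<lambda>u. inner w (\<phi>' (xb, yb) (u, 0)))
                 + grad (\<lambda>u. inner \<mu> (G' (xb, yb) (u, 0)))
           \<and> 0 \<in> (+) (grad (\<lambda>u. F' (xb, yb) (0, u)) - grad (\<lambda>u. inner lt (g'' yb u w))
                   - grad (\<lambda>u. inner w (\<phi>' (xb, yb) (0, u)))
                   + grad (\<lambda>u. inner \<mu> (G' (xb, yb) (0, u))))
                 ` polar_cone (crit_cone KG v zs)"
proof
  fix lt assume lt: "lt \<in> \<Lambda>t"

  \<comment> \<open>Polyhedral form of the critical cone\<close>
  define zb where "zb = (xb, yb)"
  define I where "I = {i. g yb $ i = 0}"
  define E where "E = {i. 0 < lt $ i}"
  define a where "a = (\<lambda>i. grad (\<lambda>u. g' yb u $ i))"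
  have a: "a i \<bullet> u = g' yb u $ i" for i u
    unfolding a_def by (rule inner_grad) (auto intro!: linearI simp: blinfun.add_right blinfun.scaleR_right)
  have sum_a: "grad (\<lambda>u. \<mu> \<bullet> g' yb u) = (\<Sum>i\<in>UNIV. \<mu> $ i *\<^sub>R a i)" for \<mu>
  proof -
    have "grad (\<lambda>u. \<mu> \<bullet> g' yb u) \<bullet> u = (\<Sum>i\<in>UNIV. \<mu> $ i *\<^sub>R a i) \<bullet> u" for u
      unfolding inner_grad[OF linear_inner_blinfun] inner_sum_left inner_scaleR_left a by (simp add: inner_vec_def)
    then show ?thesis by (rule inner_ext)
  qed
  have lt_\<Lambda>b: "lt \<in> \<Lambda>b" using lt \<Lambda>t_sub by auto
  have yb: "g yb \<in> nonpos_orthant" and lt_nn: "\<And>i. 0 \<le> lt $ i"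
    and lt_compl: "\<And>i. g yb $ i \<noteq> 0 \<Longrightarrow> lt $ i = 0"
    and ybs: "ybs = grad (\<lambda>u. lt \<bullet> g' yb u)"
    using lt_\<Lambda>b by (auto simp: \<Lambda>b_def reg_normal_nonpos_orthant)
  have EI: "E \<subseteq> I" using lt_compl by (auto simp: E_def I_def order_less_le)

  have tang: "v \<in> tangent_cone \<Gamma> yb \<longleftrightarrow> (\<forall>i\<in>I. a i \<bullet> v \<le> 0)" for v
    using tangent_cone_inequalities[OF g_deriv subreg_g, of v] unfolding \<Gamma>_def by (simp add: I_def a)
  \<comment> \<open>For tangent \<open>v\<close>, the product \<open>ybs \<bullet> v\<close> is a
    sum of nonpositive terms, so orthogonality amounts to equality at the indices where
    \<open>lt\<close> is positive.\<close>
  have KG: "KG = lin_cone a I E"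
  proof (intro equalityI subsetI)
    fix v assume "v \<in> KG"
    then have le: "\<forall>i\<in>I. a i \<bullet> v \<le> 0" and "ybs \<bullet> v = 0"
      unfolding KG_def crit_cone_def using tang by auto
    then have "(\<Sum>i\<in>UNIV. lt $ i * (a i \<bullet> v)) = 0" by (simp add: ybs sum_a inner_sum_left)
    moreover have "lt $ i * (a i \<bullet> v) \<le> 0" for i
      using le lt_nn[of i] lt_compl[of i] by (cases "i \<in> I") (auto simp: I_def mult_nonneg_nonpos)
    ultimately have "lt $ i * (a i \<bullet> v) = 0" for i
      using sum_nonpos_eq_0D[of UNIV "\<lambda>i. lt $ i * (a i \<bullet> v)" i] by auto
    then have "a i \<bullet> v = 0" if "i \<in> E" for i using that by (metis E_def less_irrefl mem_Collect_eq mult_eq_0_iff)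
    then show "v \<in> lin_cone a I E" using le by (auto simp: lin_cone_def)
  next
    fix v assume v: "v \<in> lin_cone a I E"
    have "lt $ i * (a i \<bullet> v) = 0" for i
      using v EI lt_nn[of i] by (cases "i \<in> E") (auto simp: lin_cone_def E_def order_less_le)
    then have "ybs \<bullet> v = 0" unfolding ybs sum_a inner_sum_left by (intro sum.neutral) auto
    then show "v \<in> KG" using v tang unfolding KG_def crit_cone_def by (auto simp: lin_cone_def)
  qed

  \<comment> \<open>Second derivative of the Lagrangian and the model cone\<close>
  define H where "H = (\<lambda>v. grad (\<lambda>u. lt \<bullet> g'' yb v u))"
  define Ht where "Ht = (\<lambda>w. grad (\<lambda>u. lt \<bullet> g'' yb u w))"
  have H: "H v \<bullet> u = lt \<bullet> g'' yb v u" for v u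
    unfolding H_def by (rule inner_grad[OF linear_inner_blinfun])
  have Ht: "Ht w \<bullet> u = lt \<bullet> g'' yb u w" for w u
    unfolding Ht_def by (rule inner_grad)
      (auto intro!: linearI simp: blinfun.add_right blinfun.scaleR_right blinfun.add_left
         blinfun.scaleR_left inner_add_right)
  \<comment> \<open>\<open>H\<close> shapes \<open>T'\<close>, while \<open>Ht\<close> is the
    operator in the claimed condition; adjointness links the two.\<close>
  have H_adj: "w \<bullet> H v = Ht w \<bullet> v" for v w by (metis H Ht inner_commute)
  have lin_H: "linear H"
    unfolding H_def by (intro linearI)
      (simp_all add: blinfun.add_right blinfun.scaleR_right blinfun.add_left
         blinfun.scaleR_left inner_add_right grad_add grad_scaleR)
  have contH: "continuous_on UNIV H"
    using lin_H by (simp add: linear_continuous_on linear_conv_bounded_linear)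

  define S where "S = {s::real^'p. \<forall>i. G zb $ i = 0 \<longrightarrow> s $ i \<le> 0}"
  define T where "T = tangent_cone D (P zb)"
  define T' where "T' = {((v, y), s). (v, y - H v) \<in> normal_graph KG \<and> s \<in> S}"

  have "reg_normal \<Omega>M zb \<noteq> {}" using B_stationary by (auto simp: zb_def)
  then have "zb \<in> \<Omega>M" by (auto simp: reg_normal_def split: if_splits)
  then have Gzb: "G zb \<in> nonpos_orthant" by (simp add: \<Omega>M_def zb_def P_def D_def)

  \<comment> \<open>Second-order construction of tangent directions\<close>
  have T'_sub: "T' \<subseteq> T"
  proof
    fix p assume "p \<in> T'"
    then obtain v y s where p: "p = ((v, y), s)" and vy: "(v, y - H v) \<in> normal_graph KG" and s: "s \<in> S"
      unfolding T'_def by auto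
    have vKG: "v \<in> lin_cone a I E" using vy KG by (auto simp: normal_graph_def)
    obtain \<mu> where \<mu>: "\<mu> \<in> lin_mults I E" and y: "y - H v = (\<Sum>i\<in>UNIV. \<mu> $ i *\<^sub>R a i)"
      using farkas[of "y - H v" a I E] vy KG by (auto simp: normal_graph_def)
    have compl: "\<mu> $ i * (a i \<bullet> v) = 0" for i
    proof (rule sum_nonpos_eq_0D[of UNIV "\<lambda>i. \<mu> $ i * (a i \<bullet> v)"])
      show "(\<Sum>i\<in>UNIV. \<mu> $ i * (a i \<bullet> v)) = 0"
        using vy y by (simp add: normal_graph_def inner_sum_left)
    qed (auto intro: lin_mults_inner_nonpos[OF \<mu> vKG])
    \<comment> \<open>The assumption on \<open>\<Lambda>t\<close> covers nonzero \<open>v\<close>;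
      at \<open>v = 0\<close> both sides vanish.\<close>
    have lt_max: "l' \<bullet> g'' yb v v \<le> lt \<bullet> g'' yb v v" if "l' \<in> \<Lambda>b" for l'
    proof (cases "v = 0")
      case False
      then have "lt \<in> \<Lambda>v v" using \<Lambda>t_const[of v] lt vy by (auto simp: normal_graph_def)
      then show ?thesis using that by (simp add: \<Lambda>v_def)
    qed (simp add: blinfun.zero_right)
    \<comment> \<open>The dual condition for solving the system for \<open>w\<close>:
      \<open>\<nu>\<close> is a feasible direction at \<open>lt\<close> in the polyhedron
      \<open>\<Lambda>b\<close>, where \<open>lt\<close> maximizes the linear function given by
      \<open>g'' yb v v\<close>.\<close>
    have "\<nu> \<bullet> g'' yb v v \<le> 0" if \<nu>: "\<nu> \<in> lin_mults I E" "(\<Sum>i\<in>UNIV. \<nu> $ i *\<^sub>R a i) = 0" for \<nu>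
    proof -
      have "eventually (\<lambda>\<tau>. \<forall>i\<in>UNIV. 0 \<le> lt $ i + \<tau> * \<nu> $ i) (at_right 0)"
      proof (intro eventually_ball_finite ballI)
        fix i
        show "eventually (\<lambda>\<tau>. 0 \<le> lt $ i + \<tau> * \<nu> $ i) (at_right 0)"
        proof (cases "i \<in> E")
          case True
          have "((\<lambda>\<tau>. lt $ i + \<tau> * \<nu> $ i) \<longlongrightarrow> lt $ i + 0 * \<nu> $ i) (at_right 0)"
            by (intro tendsto_intros)
          then have "eventually (\<lambda>\<tau>. 0 < lt $ i + \<tau> * \<nu> $ i) (at_right 0)"
            using True by (intro order_tendstoD) (auto simp: E_def)
          then show ?thesis by eventually_elim simp
        next
          case False
          then have "0 \<le> \<nu> $ i" using \<nu>(1) by (simp add: lin_mults_def)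
          then show ?thesis using lt_nn[of i]
            by (auto simp: eventually_at_right_field intro!: exI[of _ 1])
        qed
      qed simp
      then obtain b where b: "b > 0" "\<And>\<tau>. 0 < \<tau> \<Longrightarrow> \<tau> < b \<Longrightarrow> \<forall>i. 0 \<le> lt $ i + \<tau> * \<nu> $ i"
        by (auto simp: eventually_at_right_field)
      define \<tau> where "\<tau> = b / 2"
      have \<tau>: "0 < \<tau>" "\<tau> < b" using b(1) by (auto simp: \<tau>_def)
      have "lt + \<tau> *\<^sub>R \<nu> \<in> \<Lambda>b"
      proof -
        have "grad (\<lambda>u. (lt + \<tau> *\<^sub>R \<nu>) \<bullet> g' yb u) = ybs"
          using \<nu>(2) unfolding sum_a ybs
          by (simp add: scaleR_add_left sum.distrib scaleR_scaleR[symmetric] scaleR_sum_right[symmetric]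
               del: scaleR_scaleR)
        moreover have "\<nu> $ i = 0" if "g yb $ i \<noteq> 0" for i using that \<nu>(1) by (simp add: lin_mults_def I_def)
        ultimately show ?thesis
          using b(2)[OF \<tau>] yb lt_compl by (simp add: \<Lambda>b_def reg_normal_nonpos_orthant)
      qed
      from lt_max[OF this] have "\<tau> * (\<nu> \<bullet> g'' yb v v) \<le> 0" by (simp add: inner_add_left)
      then show ?thesis using \<tau> by (simp add: mult_le_0_iff)
    qed
    from inhomogeneous_farkas[OF this] obtain w where
      w: "\<And>i. i \<in> I \<Longrightarrow> a i \<bullet> w + g'' yb v v $ i \<le> 0 \<and> (i \<in> E \<longrightarrow> a i \<bullet> w + g'' yb v v $ i = 0)"
      by blast
    define t where "t = (\<lambda>k. 1 / real (Suc k))"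
    have t: "\<And>k. t k > 0" "t \<longlonglongrightarrow> 0"
      using LIMSEQ_inverse_real_of_nat by (auto simp: t_def inverse_eq_divide)
    have tne: "t k \<noteq> 0" for k using t(1)[of k] by simp
    have "\<exists>y ys. eventually (\<lambda>k. ys k \<in> reg_normal {y. g y \<in> nonpos_orthant} (y k)) sequentially
      \<and> (\<lambda>k. (y k - yb) /\<^sub>R t k) \<longlonglongrightarrow> v
      \<and> (\<lambda>k. (ys k - grad (\<lambda>u. lt \<bullet> g' yb u)) /\<^sub>R t k) \<longlonglongrightarrow>
         grad (\<lambda>u. lt \<bullet> g'' yb v u) + grad (\<lambda>u. \<mu> \<bullet> g' yb u)"
    proof (rule graph_normal_sequence[where g = g and g' = g' and g'' = g'' and yb = yb and l = lt and v = v
          and w = w and \<mu> = \<mu>, OF g_deriv g'_deriv subreg_g lt_nn lt_compl _ _ _ _ _ t])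
      show "g' yb v $ i \<le> 0 \<and> (0 < lt $ i \<longrightarrow> g' yb v $ i = 0)" if "g yb $ i = 0" for i
        using vKG that by (auto simp: lin_cone_def a I_def E_def)
      show "(g' yb w + g'' yb v v) $ i \<le> 0 \<and> (0 < lt $ i \<longrightarrow> (g' yb w + g'' yb v v) $ i = 0)"
        if "g yb $ i = 0" for i
        using w[of i] that by (auto simp: a I_def E_def)
      show "\<mu> $ i = 0" if "g yb $ i \<noteq> 0" for i using \<mu> that by (simp add: lin_mults_def I_def)
      show "0 \<le> \<mu> $ i" if "lt $ i = 0" for i using \<mu> that by (simp add: lin_mults_def E_def)
      show "\<mu> $ i * g' yb v $ i = 0" for i using compl[of i] by (simp add: a)
    qed
    moreover have target: "grad (\<lambda>u. lt \<bullet> g'' yb v u) + grad (\<lambda>u. \<mu> \<bullet> g' yb u) = H v + (y - H v)"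
      unfolding y sum_a by (simp only: H_def)
    ultimately obtain yk ys where ys: "eventually (\<lambda>k. ys k \<in> reg_normal \<Gamma> (yk k)) sequentially"
      and yklim: "(\<lambda>k. (yk k - yb) /\<^sub>R t k) \<longlonglongrightarrow> v"
      and yslim: "(\<lambda>k. (ys k - ybs) /\<^sub>R t k) \<longlonglongrightarrow> H v + (y - H v)"
      unfolding \<Gamma>_def ybs target[symmetric] by blast
    have "(\<lambda>k. G zb + t k *\<^sub>R s) \<longlonglongrightarrow> G zb + 0 *\<^sub>R s" by (intro tendsto_intros t)
    then have Glim: "(\<lambda>k. G zb + t k *\<^sub>R s) \<longlonglongrightarrow> G zb" by simp
    have "eventually (\<lambda>k. G zb + t k *\<^sub>R s \<in> nonpos_orthant) sequentially"
    proof (rule eventually_nonpos_orthant[OF Gzb Glim])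
      fix i k assume i: "G zb $ i = 0"
      have "t k * s $ i \<le> 0" using s i t(1)[of k] by (simp add: S_def mult_nonneg_nonpos)
      then show "(G zb + t k *\<^sub>R s) $ i \<le> 0" using i by simp
    qed
    with ys have "eventually (\<lambda>k. P zb + t k *\<^sub>R (((yk k - yb) /\<^sub>R t k, (ys k - ybs) /\<^sub>R t k), s) \<in> D) sequentially"
    proof eventually_elim
      case (elim k)
      have "P zb + t k *\<^sub>R (((yk k - yb) /\<^sub>R t k, (ys k - ybs) /\<^sub>R t k), s) = ((yk k, ys k), G zb + t k *\<^sub>R s)"
        using tne[of k] by (simp add: zb_def P_def ybs_def)
      then show ?case using elim by (simp add: D_def gph_def)
    qed
    moreover have "(\<lambda>k. (((yk k - yb) /\<^sub>R t k, (ys k - ybs) /\<^sub>R t k), s)) \<longlonglongrightarrow> p"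
      using yslim unfolding p by (intro tendsto_Pair yklim tendsto_const) simp
    ultimately show "p \<in> T" unfolding T_def by (intro tangent_coneI_sequentially[OF t])
  qed

  \<comment> \<open>Exact penalty for the linearized problem\<close>
  define f where "f = grad (blinfun_apply (F' zb))"
  have f: "f \<bullet> h = F' zb h" for h
    unfolding f_def by (rule inner_grad) (rule bounded_linear.linear[OF blinfun.bounded_linear_right])
  have lin_DP: "linear DP"
  proof -
    have "DP h = ((snd h, - \<phi>' zb h), G' zb h)" for h by (cases h) (simp add: DP_def zb_def)
    then show ?thesis by (intro linearI) (simp_all add: blinfun.add_right blinfun.scaleR_right)
  qed
  have conic_T': "conic T'"
    unfolding conic_def
  proof clarify
    fix v y s and c :: real assume T': "((v, y), s) \<in> T'" "0 \<le> c"
    then have "(c *\<^sub>R v, c *\<^sub>R (y - H v)) \<in> normal_graph KG"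
      by (intro conic_normal_graph) (auto simp: T'_def KG conic_lin_cone)
    then show "c *\<^sub>R ((v, y), s) \<in> T'"
      using T' by (auto simp: T'_def S_def linear_scale[OF lin_H] scaleR_diff_right mult_nonneg_nonpos)
  qed
  have "closed S"
  proof -
    have "S = (\<Inter>i\<in>{i. G zb $ i = 0}. {s. s $ i \<le> 0})" by (auto simp: S_def)
    then show ?thesis by (auto intro!: closed_INT closed_Collect_le continuous_intros)
  qed
  have "closed T'"
  proof -
    have eq: "T' = (\<lambda>p. (fst (fst p), snd (fst p) - H (fst (fst p)))) -` normal_graph KG \<inter> snd -` S"
      by (auto simp: T'_def)
    have "closed ((\<lambda>p. (fst (fst p), snd (fst p) - H (fst (fst p)))) -` normal_graph KG :: (((real^'m) \<times> (real^'m)) \<times> (real^'p)) set)"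
      by (intro closed_vimage closed_normal_graph continuous_intros continuous_on_compose2[OF contH])
         (auto simp: KG closed_lin_cone)
    moreover have "closed (snd -` S :: (((real^'m) \<times> (real^'m)) \<times> (real^'p)) set)"
      by (intro closed_vimage \<open>closed S\<close> continuous_intros)
    ultimately show ?thesis unfolding eq by (rule closed_Int)
  qed
  have "0 \<in> T'"
    by (auto simp: T'_def zero_prod_def linear_0[OF lin_H] normal_graph_def KG lin_cone_def polar_cone_def S_def)

  \<comment> \<open>B-stationarity makes \<open>- f\<close> a regular normal to the feasible set. By
    GGCQ this means polarity to the linearized cone.\<close>
  have "0 \<le> f \<bullet> h" if "DP h \<in> T" for h
  proof -
    obtain n where n: "n \<in> reg_normal \<Omega>M zb" "0 = f + n"
      using B_stationary unfolding f_def zb_def by auto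
    then have "n = - f" by (simp add: eq_neg_iff_add_eq_0 add.commute)
    then have "- f \<in> polar_cone {uv. DP uv \<in> T}" using n GGCQ by (simp add: zb_def T_def)
    then show ?thesis using that by (cases h) (auto simp: polar_cone_def)
  qed
  from subregular_cone_penalty[OF lin_DP _ conic_T' T'_sub this]
  obtain C where C: "C \<ge> 0" "\<And>z t. t \<in> T' \<Longrightarrow> - C * norm (DP z - t) \<le> f \<bullet> z"
    using subreg_lin unfolding T_def zb_def zero_prod_def by blast

  \<comment> \<open>Normals to the model cone\<close>
  define NC where "NC = (\<lambda>K. {((\<alpha>, \<beta>), \<mu>). \<alpha> + Ht \<beta> \<in> polar_cone K \<and> \<beta> \<in> K
                         \<and> \<mu> \<in> reg_normal nonpos_orthant (G zb)})"
  \<comment> \<open>Subtracting \<open>H v\<close> from \<open>y\<close> is a linear change of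
    variables, under which a normal \<open>(\<alpha>, \<beta>)\<close> corresponds to the normal
    \<open>(\<alpha> + Ht \<beta>, \<beta>)\<close> of the normal graph. \<open>N t\<close> depends
    on \<open>t\<close> only through the critical cone, hence takes finitely many values.\<close>
  define N where "N = (\<lambda>((v, y), s :: real^'p). NC (crit_cone KG v (y - H v)))"
  have lin_Ht: "linear Ht"
    unfolding Ht_def by (intro linearI)
      (simp_all add: blinfun.add_right blinfun.scaleR_right inner_add_right grad_add grad_scaleR)
  have contHt: "continuous_on UNIV Ht"
    using lin_Ht by (simp add: linear_continuous_on linear_conv_bounded_linear)
  have cl_normal: "closed (reg_normal nonpos_orthant (G zb))"
    using Gzb by (simp add: reg_normal_def polar_cone_closed)
  have closed_NC: "closed (NC K)" if "closed K" for K
  proof -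
    have eq: "NC K = (\<lambda>p. fst (fst p) + Ht (snd (fst p))) -` polar_cone K
        \<inter> (\<lambda>p. snd (fst p)) -` K \<inter> snd -` reg_normal nonpos_orthant (G zb)"
      by (auto simp: NC_def)
    show ?thesis unfolding eq
      by (intro closed_Int closed_vimage polar_cone_closed that cl_normal continuous_intros
            continuous_on_compose2[OF contHt]) auto
  qed
  have closed_N: "closed (N t)" if t: "t \<in> T'" for t
  proof -
    obtain v y s where tt: "t = ((v, y), s)" by (metis surj_pair)
    have vy: "(v, y - H v) \<in> normal_graph (lin_cone a I E)" using t by (simp add: tt T'_def KG)
    then obtain \<mu> where \<mu>: "\<mu> \<in> lin_mults I E" "y - H v = (\<Sum>i\<in>UNIV. \<mu> $ i *\<^sub>R a i)"
      using farkas[of "y - H v" a I E] by (auto simp: normal_graph_def)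
    have "closed (crit_cone KG v (y - H v))"
      using crit_cone_lin_cone[OF _ \<mu>] vy by (simp add: KG normal_graph_def closed_lin_cone)
    then show ?thesis by (simp add: tt N_def closed_NC)
  qed
  have fin_N: "finite (N ` T')"
  proof (rule finite_subset)
    show "N ` T' \<subseteq> NC ` ((\<lambda>(v, z). crit_cone (lin_cone a I E) v z) ` normal_graph (lin_cone a I E))"
      by (auto simp: N_def T'_def KG image_iff intro!: bexI)
    show "finite (NC ` ((\<lambda>(v, z). crit_cone (lin_cone a I E) v z) ` normal_graph (lin_cone a I E)))"
      by (intro finite_imageI finite_crit_cones)
  qed
  have normals: "radial_normals T' t \<subseteq> N t" if t: "t \<in> T'" for t
  proof
    fix \<zeta> assume \<zeta>: "\<zeta> \<in> radial_normals T' t"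
    obtain v y s where tt: "t = ((v, y), s)" by (metis surj_pair)
    obtain \<alpha> \<beta> \<mu> where z: "\<zeta> = ((\<alpha>, \<beta>), \<mu>)" by (metis surj_pair)
    have vy: "(v, y - H v) \<in> normal_graph KG" and s: "s \<in> S" using t by (auto simp: tt T'_def)
    have "(\<alpha> + Ht \<beta>, \<beta>) \<in> radial_normals (normal_graph KG) (v, y - H v)"
      unfolding radial_normals_def
    proof (intro CollectI allI impI)
      fix d and \<tau>0 :: real
      assume \<tau>0: "\<tau>0 > 0" "\<forall>\<tau>. 0 < \<tau> \<longrightarrow> \<tau> \<le> \<tau>0 \<longrightarrow> (v, y - H v) + \<tau> *\<^sub>R d \<in> normal_graph KG"
      obtain dv dz where d: "d = (dv, dz)" by (metis surj_pair)
      \<comment> \<open>The inverse change of variables carries a segment of the normal graph to one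
        of \<open>T'\<close>, with direction \<open>(dv, H dv + dz)\<close>.\<close>
      have "\<zeta> \<bullet> ((dv, H dv + dz), 0) \<le> 0"
      proof (rule radial_normalsD[OF \<zeta> \<tau>0(1)])
        fix \<tau> assume \<tau>: "0 < \<tau>" "\<tau> \<le> \<tau>0"
        then have "(v + \<tau> *\<^sub>R dv, y - H v + \<tau> *\<^sub>R dz) \<in> normal_graph KG" using \<tau>0(2) by (simp add: d)
        moreover have "y + \<tau> *\<^sub>R (H dv + dz) - H (v + \<tau> *\<^sub>R dv) = y - H v + \<tau> *\<^sub>R dz"
          by (simp add: linear_add[OF lin_H] linear_scale[OF lin_H] algebra_simps)
        ultimately have "(v + \<tau> *\<^sub>R dv, y + \<tau> *\<^sub>R (H dv + dz) - H (v + \<tau> *\<^sub>R dv)) \<in> normal_graph KG"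
          by (simp only:)
        then show "t + \<tau> *\<^sub>R ((dv, H dv + dz), 0) \<in> T'" using s by (simp add: tt T'_def)
      qed
      then show "(\<alpha> + Ht \<beta>, \<beta>) \<bullet> d \<le> 0"
        by (simp add: z d inner_add_left inner_add_right H_adj)
    qed
    then have "\<alpha> + Ht \<beta> \<in> polar_cone (crit_cone KG v (y - H v)) \<and> \<beta> \<in> crit_cone KG v (y - H v)"
      using radial_normals_normal_graph[of v "y - H v" a I E] vy unfolding KG by blast
    moreover have "\<mu> \<in> reg_normal nonpos_orthant (G zb)"
    proof -
      \<comment> \<open>With \<open>(v, y)\<close> fixed, \<open>s\<close> may move downward in
        every coordinate and upward where the constraint on \<open>G\<close> is inactive.\<close>
      have test: "\<mu> \<bullet> d \<le> 0" if "\<And>\<tau>. 0 < \<tau> \<Longrightarrow> s + \<tau> *\<^sub>R d \<in> S" for d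
      proof -
        have "\<zeta> \<bullet> ((0, 0), d) \<le> 0"
          by (rule radial_normalsD[OF \<zeta> zero_less_one]) (use that vy in \<open>simp add: tt T'_def\<close>)
        then show ?thesis by (simp add: z)
      qed
      have nn: "0 \<le> \<mu> $ i" for i
      proof -
        have "\<mu> \<bullet> axis i (- 1) \<le> 0"
        proof (rule test)
          fix \<tau> :: real assume "0 < \<tau>"
          then have "(s + \<tau> *\<^sub>R axis i (- 1)) $ j \<le> s $ j" for j by (simp add: axis_def)
          then show "s + \<tau> *\<^sub>R axis i (- 1) \<in> S" using s unfolding S_def by (blast intro: order_trans)
        qed
        then show ?thesis by (simp add: inner_axis)
      qed
      moreover have "\<mu> $ i = 0" if "G zb $ i \<noteq> 0" for i
      proof -
        have "\<mu> \<bullet> axis i 1 \<le> 0" using that s by (intro test) (auto simp: S_def axis_def)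
        then show ?thesis using nn[of i] by (simp add: inner_axis)
      qed
      ultimately show ?thesis using Gzb by (simp add: reg_normal_nonpos_orthant)
    qed
    ultimately show "\<zeta> \<in> N t" by (simp add: z tt N_def NC_def)
  qed

  \<comment> \<open>Reading off the multipliers\<close>
  from penalized_multiplier[OF lin_DP \<open>closed T'\<close> \<open>0 \<in> T'\<close> C(1) C(2) normals fin_N closed_N]
  obtain t \<zeta> where t: "t \<in> T'" and \<zeta>: "\<zeta> \<in> N t" and eq: "\<And>h. f \<bullet> h + \<zeta> \<bullet> DP h = 0" by blast
  obtain v y s where tt: "t = ((v, y), s)" by (metis surj_pair)
  obtain \<alpha> \<beta> \<mu> where z: "\<zeta> = ((\<alpha>, \<beta>), \<mu>)" by (metis surj_pair)
  define zs where "zs = y - H v"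
  have vz: "(v, zs) \<in> normal_graph KG" using t by (simp add: tt T'_def zs_def)
  have pol: "\<alpha> + Ht \<beta> \<in> polar_cone (crit_cone KG v zs)" and \<beta>: "\<beta> \<in> crit_cone KG v zs"
    and \<mu>: "\<mu> \<in> reg_normal nonpos_orthant (G zb)"
    using \<zeta> by (auto simp: z tt N_def NC_def zs_def)
  \<comment> \<open>The first component of \<open>DP (u, v)\<close> is \<open>v\<close> itself and
    the second is \<open>- \<phi>' zb (u, v)\<close>, so \<open>\<beta>\<close> takes the role of
    the multiplier \<open>w\<close>.\<close>
  have st: "F' zb (u, v) + \<alpha> \<bullet> v - \<beta> \<bullet> \<phi>' zb (u, v) + \<mu> \<bullet> G' zb (u, v) = 0" for u v
    using eq[of "(u, v)"] by (simp add: f z DP_def zb_def)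
  have F1: "grad (\<lambda>u. F' zb (u, 0)) \<bullet> u = F' zb (u, 0)" for u
    using inner_grad[OF linear_inner_blinfun_fst[of "1::real" "F' zb"], of u] by simp
  have F2: "grad (\<lambda>u. F' zb (0, u)) \<bullet> u = F' zb (0, u)" for u
    using inner_grad[OF linear_inner_blinfun_snd[of "1::real" "F' zb"], of u] by simp
  define X where "X = grad (\<lambda>u. F' zb (u, 0)) - grad (\<lambda>u. \<beta> \<bullet> \<phi>' zb (u, 0)) + grad (\<lambda>u. \<mu> \<bullet> G' zb (u, 0))"
  define Y where "Y = grad (\<lambda>u. F' zb (0, u)) - Ht \<beta> - grad (\<lambda>u. \<beta> \<bullet> \<phi>' zb (0, u)) + grad (\<lambda>u. \<mu> \<bullet> G' zb (0, u))"
  have "X \<bullet> u = 0" for u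
    unfolding X_def using st[of u 0]
    by (simp add: inner_add_left inner_diff_left F1 inner_grad[OF linear_inner_blinfun_fst])
  then have X: "0 = X" by (intro inner_ext[where 'a = "real^'n"]) simp
  \<comment> \<open>The added \<open>Ht \<beta>\<close> cancels the one in \<open>Y\<close>, so that
    \<open>\<alpha>\<close> is traded for an element of the polar cone.\<close>
  have "(Y + (\<alpha> + Ht \<beta>)) \<bullet> u = 0" for u
    unfolding Y_def using st[of 0 u]
    by (simp add: inner_add_left inner_diff_left F2 inner_grad[OF linear_inner_blinfun_snd])
  then have "0 = Y + (\<alpha> + Ht \<beta>)" by (intro inner_ext[where 'a = "real^'m"]) simp
  then have Y: "0 \<in> (+) Y ` polar_cone (crit_cone KG v zs)" using pol by (rule image_eqI)
  show "\<exists>v zs w \<mu>. v \<in> KG \<and> zs \<in> reg_normal KG v \<and> w \<in> crit_cone KG v zs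
           \<and> \<mu> \<in> reg_normal nonpos_orthant (G (xb, yb))
           \<and> 0 = grad (\<lambda>u. F' (xb, yb) (u, 0)) - grad (\<lambda>u. inner w (\<phi>' (xb, yb) (u, 0)))
                 + grad (\<lambda>u. inner \<mu> (G' (xb, yb) (u, 0)))
           \<and> 0 \<in> (+) (grad (\<lambda>u. F' (xb, yb) (0, u)) - grad (\<lambda>u. inner lt (g'' yb u w))
                   - grad (\<lambda>u. inner w (\<phi>' (xb, yb) (0, u)))
                   + grad (\<lambda>u. inner \<mu> (G' (xb, yb) (0, u))))
                 ` polar_cone (crit_cone KG v zs)"
    using vz normal_graph_reg_normal[OF vz] \<beta> \<mu> X Y unfolding X_def Y_def Ht_def zb_def
    by (intro exI[of _ v] exI[of _ zs] exI[of _ \<beta>] exI[of _ \<mu>] conjI) (auto simp: normal_graph_def)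
qed

end
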